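(* Let $V$ be an $\mathbb{N}$-graded vertex algebra and $M$ an $A(V)$-module. Then in $S_1(M)$, the image of $M$ (the degree-$0$ subspace $(S_1(M))_{(0)}$) intersects $\mathcal{J}$ trivially: $\mathcal{J}\cap M=0$.
   Context: An $\mathbb{N}$-graded vertex algebra is a vertex algebra $(V,Y,\mathbf{1})$ with $V=\coprod_{n\in\mathbb{Z}}V_{(n)}$, $V_{(n)}=0$ for $n<0$, and $[d,Y(u,x)]=x\frac{d}{dx}Y(u,x)+Y(du,x)$ where $du=nu$ for $u\in V_{(n)}$; write $\mathrm{wt}\,u=n$ for $u\in V_{(n)}$, $Y(u,x)=\sum_nu_nx^{-n-1}$, and $L(0)=d$, so $x^{L(0)}u=x^{\mathrm{wt}\,u}u$ for homogeneous $u$. Zhu's algebra: $O(V)$ is the span of $\mathrm{Res}_xx^nY((x+1)^{L(0)}u,x)v$ for $u,v\in V$, $n\le-2$; $A(V)=V/O(V)$ with associative product $u*v=\mathrm{Res}_xx^{-1}Y((x+1)^{L(0)}u,x)v$. Construction: let $\rho$ be the representation of $A(V)$ on $M$. In $V[t,t^{-1}]=V\otimes\mathbb{C}[t,t^{-1}]$ write $u(m)=u\otimes t^m$; let $T(V[t,t^{-1}])$ be its tensor algebra, acting on the left on $T(V[t,t^{-1}])\otimes M$, which is spanned by $u_1(m_1)\cdots u_r(m_r)w$ ($w\in M$) of degree $\sum_i(\mathrm{wt}\,u_i-m_i-1)$ for homogeneous $u_i$ (elements of $M$ have degree $0$). Put $Y_t(u,x)=\sum_mu(m)x^{-m-1}$,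 $o_t(u)=u(\mathrm{wt}\,u-1)$ for homogeneous $u$. Let $\mathcal{I}$ be the $T(V[t,t^{-1}])$-submodule generated by: (1) $u(m)w$ for homogeneous $u$ and homogeneous $w\in T(V[t,t^{-1}])\otimes M$ with $\mathrm{wt}\,u-m-1+\deg w<0$; (2) $o_t(u)w-\rho(u+O(V))w$ for $u\in V$, $w\in M$; (3) $u(p)v(q)w-\sum_{i=0}^{\mathrm{wt}\,v+\deg w-q-1}\sum_{j=0}^{\mathrm{wt}\,u+\deg w}\binom{p-\mathrm{wt}\,u-\deg w}{i}\binom{\mathrm{wt}\,u+\deg w}{j}(u_{p-\mathrm{wt}\,u-\deg w-i+j}v)(q+\mathrm{wt}\,u+\deg w+i-j)w$ for homogeneous $u,v$, homogeneous $w$, $p,q\in\mathbb{Z}$ with $\mathrm{wt}\,v+\deg w>q$ and $\mathrm{wt}\,u-p-1+\mathrm{wt}\,v-q-1+\deg w\ge0$. $S_1(M)=(T(V[t,t^{-1}])\otimes M)/\mathcal{I}$, a graded $T(V[t,t^{-1}])$-module, with $Y_{S_1(M)}$ induced by $Y_t$; $M$ is identified with its image (the degree-$0$ part) in $S_1(M)$. $\mathcal{J}$ is the $T(V[t,t^{-1}])$-submodule of $S_1(M)$ generated by $\sum_{j=0}^{\mathrm{wt}\,u+\deg w}\binom{\mathrm{wt}\,u+\deg w}{j}(u_{p-i-j}v)(q+i+j)w$ (i.e. $\mathrm{Res}_{x_0}\mathrm{Res}_{x_2}x_0^{p-\mathrm{wt}\,u-\deg w-i}x_2^{q+i}(x_0+x_2)^{\mathrm{wt}\,u+\deg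 w}Y_{S_1(M)}(Y(u,x_0)v,x_2)w$) for homogeneous $u,v\in V$, homogeneous $w\in S_1(M)$, $p,q\in\mathbb{Z}$ and integers $i\ge\mathrm{wt}\,v+\deg w-q$. *)

theory Defs
  imports Complex_Main
begin

text \<open>A vertex algebra over the complex numbers: carrier type 'v (additive group) with scalar
multiplication sV, vertex operator in components Y u n v = u_n v, and vacuum vac.
Axioms: bilinearity, truncation, vacuum and creation properties, and the Jacobi identity in its
component (Borcherds) form.\<close>

definition fsum :: "(nat \<Rightarrow> 'a::comm_monoid_add) \<Rightarrow> 'a" where
  "fsum f = (\<Sum>i\<in>{i. f i \<noteq> 0}. f i)"

definition sgnpow :: "int \<Rightarrow> complex" where
  "sgnpow r = (if even r then 1 else -1)"

definition bilinear_Y :: "(complex \<Rightarrow> 'v::ab_group_add \<Rightarrow> 'v) \<Rightarrow> ('v \<Rightarrow> int \<Rightarrow> 'v \<Rightarrow> 'v) \<Rightarrow> bool" where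
  "bilinear_Y sV Y \<longleftrightarrow>
     (\<forall>c u u' n v. Y (sV c u + u') n v = sV c (Y u n v) + Y u' n v) \<and>
     (\<forall>c u n v v'. Y u n (sV c v + v') = sV c (Y u n v) + Y u n v')"

definition vertex_algebra ::
  "(complex \<Rightarrow> 'v::ab_group_add \<Rightarrow> 'v) \<Rightarrow> ('v \<Rightarrow> int \<Rightarrow> 'v \<Rightarrow> 'v) \<Rightarrow> 'v \<Rightarrow> bool" where
  "vertex_algebra sV Y vac \<longleftrightarrow>
     Vector_Spaces.vector_space sV \<and> bilinear_Y sV Y \<and>
     (\<forall>u v. \<exists>N. \<forall>n\<ge>N. Y u n v = 0) \<and>
     (\<forall>n v. Y vac n v = (if n = -1 then v else 0)) \<and>
     (\<forall>v. (\<forall>n\<ge>0. Y v n vac = 0) \<and> Y v (-1) vac = v) \<and>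
     (\<forall>u v w p q r.
        fsum (\<lambda>i. sV ((of_int p) gchoose i) (Y (Y u (r + int i) v) (p + q - int i) w)) =
        fsum (\<lambda>i. sV ((-1) ^ i * ((of_int r) gchoose i))
                     (Y u (p + r - int i) (Y v (q + int i) w)
                      - sV (sgnpow r) (Y v (q + r - int i) (Y u (p + int i) w)))))"

definition subsp :: "(complex \<Rightarrow> 'v::ab_group_add \<Rightarrow> 'v) \<Rightarrow> 'v set \<Rightarrow> bool" where
  "subsp sV S \<longleftrightarrow> 0 \<in> S \<and> (\<forall>x\<in>S. \<forall>y\<in>S. x + y \<in> S) \<and> (\<forall>c. \<forall>x\<in>S. sV c x \<in> S)"

text \<open>N-graded vertex algebra: V = direct sum of the V_(n) (n integer), V_(n) = 0 for n < 0, and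
the commutator formula [d, Y(u,x)] = x d/dx Y(u,x) + Y(du,x), which in components says
u_m v \<in> V_(k+l-m-1) for u \<in> V_(k), v \<in> V_(l).\<close>

definition N_graded_VA ::
  "(complex \<Rightarrow> 'v::ab_group_add \<Rightarrow> 'v) \<Rightarrow> ('v \<Rightarrow> int \<Rightarrow> 'v \<Rightarrow> 'v) \<Rightarrow> 'v \<Rightarrow> (int \<Rightarrow> 'v set) \<Rightarrow> bool" where
  "N_graded_VA sV Y vac Vg \<longleftrightarrow>
     vertex_algebra sV Y vac \<and>
     (\<forall>n. subsp sV (Vg n)) \<and>
     (\<forall>n<0. Vg n = {0}) \<and>
     (\<forall>v. \<exists>F c. finite F \<and> (\<forall>n\<in>F. c n \<in> Vg n) \<and> v = sum c F) \<and>
     (\<forall>F c. finite F \<and> (\<forall>n\<in>F. c n \<in> Vg n) \<and> sum c F = 0 \<longrightarrow> (\<forall>n\<in>F. c n = 0)) \<and>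
     (\<forall>k l m u v. u \<in> Vg k \<longrightarrow> v \<in> Vg l \<longrightarrow> Y u m v \<in> Vg (k + l - m - 1))"

text \<open>For u \<in> V_(n): Res_x x^k Y((x+1)^L(0) u, x) v = sum_j (n choose j) u_(k+j) v; O(V) is spanned
by these for k \<le> -2, and u * v is the case k = -1.\<close>

definition zhu_O_gen :: "(complex \<Rightarrow> 'v::ab_group_add \<Rightarrow> 'v) \<Rightarrow> ('v \<Rightarrow> int \<Rightarrow> 'v \<Rightarrow> 'v) \<Rightarrow> int \<Rightarrow> 'v \<Rightarrow> int \<Rightarrow> 'v \<Rightarrow> 'v" where
  "zhu_O_gen sV Y n u k v = (\<Sum>j\<le>nat n. sV (of_nat (nat n choose j)) (Y u (k + int j) v))"

definition zhu_star :: "(complex \<Rightarrow> 'v::ab_group_add \<Rightarrow> 'v) \<Rightarrow> ('v \<Rightarrow> int \<Rightarrow> 'v \<Rightarrow> 'v) \<Rightarrow> int \<Rightarrow> 'v \<Rightarrow> 'v \<Rightarrow> 'v" where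
  "zhu_star sV Y n u v = zhu_O_gen sV Y n u (-1) v"

text \<open>An A(V)-module M (vector space with scalar multiplication sM) with representation
rho(u + O(V)) = rho u: rho is bilinear, vanishes on O(V), is multiplicative for the Zhu product
and sends the identity 1 + O(V) of A(V) to the identity.\<close>

definition AV_module ::
  "(complex \<Rightarrow> 'v::ab_group_add \<Rightarrow> 'v) \<Rightarrow> ('v \<Rightarrow> int \<Rightarrow> 'v \<Rightarrow> 'v) \<Rightarrow> 'v \<Rightarrow> (int \<Rightarrow> 'v set) \<Rightarrow>
   (complex \<Rightarrow> 'm::ab_group_add \<Rightarrow> 'm) \<Rightarrow> ('v \<Rightarrow> 'm \<Rightarrow> 'm) \<Rightarrow> bool" where
  "AV_module sV Y vac Vg sM rho \<longleftrightarrow>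
     Vector_Spaces.vector_space sM \<and>
     (\<forall>c u u' w. rho (sV c u + u') w = sM c (rho u w) + rho u' w) \<and>
     (\<forall>c u w w'. rho u (sM c w + w') = sM c (rho u w) + rho u w') \<and>
     (\<forall>n u k v w. u \<in> Vg n \<longrightarrow> k \<le> -2 \<longrightarrow> rho (zhu_O_gen sV Y n u k v) w = 0) \<and>
     (\<forall>n u v w. u \<in> Vg n \<longrightarrow> rho (zhu_star sV Y n u v) w = rho u (rho v w)) \<and>
     (\<forall>w. rho vac w = w)"

text \<open>T(V[t,t^-1]) \<otimes> M is realised as the free vector space on keys (ws, w), where
ws = [(n1,u1,m1),...,(nr,ur,mr)] with u_i \<in> V_(n_i) stands for u1(m1)...ur(mr) and w \<in> M,
modulo the multilinearity relations (LinGen).  Elements of the free space are finitely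
supported complex-valued functions on keys.\<close>

type_synonym ('v,'m) key = "(int \<times> 'v \<times> int) list \<times> 'm"

definition validw :: "(int \<Rightarrow> 'v set) \<Rightarrow> (int \<times> 'v \<times> int) list \<Rightarrow> bool" where
  "validw Vg ws \<longleftrightarrow> (\<forall>(n,u,m)\<in>set ws. u \<in> Vg n)"

definition deg_key :: "('v,'m) key \<Rightarrow> int" where
  "deg_key x = sum_list (map (\<lambda>(n,u,m). n - m - 1) (fst x))"

definition ebas :: "('v,'m) key \<Rightarrow> ('v,'m) key \<Rightarrow> complex" where
  "ebas k = (\<lambda>x. if x = k then 1 else 0)"

definition homog :: "(int \<Rightarrow> 'v set) \<Rightarrow> int \<Rightarrow> (('v,'m) key \<Rightarrow> complex) \<Rightarrow> bool" where
  "homog Vg d f \<longleftrightarrow> finite {x. f x \<noteq> 0} \<and>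
     (\<forall>x. f x \<noteq> 0 \<longrightarrow> validw Vg (fst x) \<and> deg_key x = d)"

definition lspan :: "('a \<Rightarrow> complex) set \<Rightarrow> ('a \<Rightarrow> complex) set" where
  "lspan S = {f. \<exists>F c. finite F \<and> F \<subseteq> S \<and> f = (\<lambda>x. \<Sum>g\<in>F. c g * g x)}"

definition act :: "int \<times> 'v \<times> int \<Rightarrow> (('v,'m) key \<Rightarrow> complex) \<Rightarrow> ('v,'m) key \<Rightarrow> complex" where
  "act a f = (\<lambda>(ws, w). case ws of [] \<Rightarrow> 0 | b # ws' \<Rightarrow> (if b = a then f (ws', w) else 0))"

definition actw :: "(int \<times> 'v \<times> int) list \<Rightarrow> (('v,'m) key \<Rightarrow> complex) \<Rightarrow> ('v,'m) key \<Rightarrow> complex" where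
  "actw ws f = foldr act ws f"

definition Tsub :: "(int \<Rightarrow> 'v set) \<Rightarrow> (('v,'m) key \<Rightarrow> complex) set \<Rightarrow> (('v,'m) key \<Rightarrow> complex) set" where
  "Tsub Vg G = lspan {actw ws g | ws g. validw Vg ws \<and> g \<in> G}"

definition LinGen ::
  "(complex \<Rightarrow> 'v::ab_group_add \<Rightarrow> 'v) \<Rightarrow> (int \<Rightarrow> 'v set) \<Rightarrow> (complex \<Rightarrow> 'm::ab_group_add \<Rightarrow> 'm) \<Rightarrow>
   (('v,'m) key \<Rightarrow> complex) set" where
  "LinGen sV Vg sM =
     {(\<lambda>x. ebas (xs @ [(n, sV c u + u', m)] @ ys, w) x - c * ebas (xs @ [(n, u, m)] @ ys, w) x
            - ebas (xs @ [(n, u', m)] @ ys, w) x)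
       | xs ys n u u' m c w. validw Vg xs \<and> validw Vg ys \<and> u \<in> Vg n \<and> u' \<in> Vg n}
   \<union> {(\<lambda>x. ebas (ws, sM c w + w') x - c * ebas (ws, w) x - ebas (ws, w') x)
       | ws c w w'. validw Vg ws}"

definition Gen1 :: "(int \<Rightarrow> 'v set) \<Rightarrow> (('v,'m) key \<Rightarrow> complex) set" where
  "Gen1 Vg = {act (n, u, m) f | n u m f d. u \<in> Vg n \<and> homog Vg d f \<and> n - m - 1 + d < 0}"

definition Gen2 :: "(int \<Rightarrow> 'v set) \<Rightarrow> ('v \<Rightarrow> 'm \<Rightarrow> 'm) \<Rightarrow> (('v,'m) key \<Rightarrow> complex) set" where
  "Gen2 Vg rho = {(\<lambda>x. ebas ([(n, u, n - 1)], w) x - ebas ([], rho u w) x) | n u w. u \<in> Vg n}"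

definition Gen3 :: "('v \<Rightarrow> int \<Rightarrow> 'v \<Rightarrow> 'v) \<Rightarrow> (int \<Rightarrow> 'v set) \<Rightarrow> (('v,'m) key \<Rightarrow> complex) set" where
  "Gen3 Y Vg =
     {(\<lambda>x. act (n1, u, p) (act (n2, v, q) f) x -
          (\<Sum>i<nat (n2 + d - q). \<Sum>j\<in>{0..n1 + d}.
             ((of_int (p - n1 - d)) gchoose i) * ((of_int (n1 + d)) gchoose (nat j)) *
             act (n1 + n2 - (p - n1 - d - int i + j) - 1, Y u (p - n1 - d - int i + j) v,
                  q + n1 + d + int i - j) f x))
      | n1 n2 u v p q d f. u \<in> Vg n1 \<and> v \<in> Vg n2 \<and> homog Vg d f \<and> n2 + d > q \<and>
          n1 - p - 1 + n2 - q - 1 + d \<ge> 0}"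

definition Igen ::
  "(complex \<Rightarrow> 'v::ab_group_add \<Rightarrow> 'v) \<Rightarrow> ('v \<Rightarrow> int \<Rightarrow> 'v \<Rightarrow> 'v) \<Rightarrow> (int \<Rightarrow> 'v set) \<Rightarrow>
   (complex \<Rightarrow> 'm::ab_group_add \<Rightarrow> 'm) \<Rightarrow> ('v \<Rightarrow> 'm \<Rightarrow> 'm) \<Rightarrow> (('v,'m) key \<Rightarrow> complex) set" where
  "Igen sV Y Vg sM rho = LinGen sV Vg sM \<union> Gen1 Vg \<union> Gen2 Vg rho \<union> Gen3 Y Vg"

definition Jgen :: "('v \<Rightarrow> int \<Rightarrow> 'v \<Rightarrow> 'v) \<Rightarrow> (int \<Rightarrow> 'v set) \<Rightarrow> (('v,'m) key \<Rightarrow> complex) set" where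
  "Jgen Y Vg =
     {(\<lambda>x. \<Sum>j\<in>{0..n1 + d}. ((of_int (n1 + d)) gchoose (nat j)) *
             act (n1 + n2 - (p - i - j) - 1, Y u (p - i - j) v, q + i + j) f x)
      | n1 n2 u v p q d f i. u \<in> Vg n1 \<and> v \<in> Vg n2 \<and> homog Vg d f \<and> i \<ge> n2 + d - q}"

end

theory Submission
  imports Defs
begin

text \<open>The point is that \<open>M\<close> embeds into a module on which both \<open>\<I>\<close> and \<open>\<J>\<close> act as zero, so that
\<open>w \<in> \<I> + \<J>\<close> forces \<open>w = 0\<close>. The module is cogenerated by its top: after composing with a linear
form on \<open>M\<close>, a vector \<open>x\<close> of degree \<open>d\<close> is replaced by the family of its matrix coefficients
\<open>\<phi>(c) = c(wt c - 1 + d) x\<close>, and \<open>w \<in> M\<close> by \<open>\<phi>(c) = \<rho>(c) w\<close>. Relation (3) dictates how \<open>u(q)\<close> must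
act: \<open>(u(q)\<phi>)(c)\<close> is the residue at \<open>y = \<infinity>\<close> of \<open>(1 + y)\<^sup>n \<phi>(Y(c,y)u)\<close> with
\<open>n = wt c + wt u + d - q - 2\<close>. The condition replacing \<open>O(V)\<close> in degree \<open>d\<close>, namely that
\<open>(1 + y)\<^sup>k\<^sup>+\<^sup>d \<phi>(Y(c,y)b)\<close> (\<open>k = wt c\<close>) is a Laurent polynomial of degree at most \<open>d\<close>, makes these
residues well defined and is preserved by the action. Both this and the relations (3) and \<open>\<J>\<close> reduce
to the three-point functions \<open>\<phi>(Y(c,x\<^sub>1)Y(u,x\<^sub>2)v)\<close>: the commutator formula bounds their total degree by
\<open>2d\<close>, which is \<open>\<J>\<close>, and the Jacobi identity expanded at infinity gives (3) and stability.\<close>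

section \<open>Binomial sums\<close>

definition fin_supp :: "(nat \<Rightarrow> complex) \<Rightarrow> bool" where
  "fin_supp h \<longleftrightarrow> (\<exists>N. \<forall>i\<ge>N. h i = 0)"

text \<open>\<open>bsum n h\<close> pairs \<open>h\<close> with the expansion of (1 + y)^n in powers
  of y; \<open>n\<close> may be negative, and finite support of \<open>h\<close> then takes the
  place of convergence.\<close>

definition bsum :: "int \<Rightarrow> (nat \<Rightarrow> complex) \<Rightarrow> complex" where
  "bsum n h = (\<Sum>i. (of_int n gchoose i) * h i)"

lemma fin_supp_add: "fin_supp f \<Longrightarrow> fin_supp g \<Longrightarrow> fin_supp (\<lambda>i. f i + g i)"
  unfolding fin_supp_def by (metis add.right_neutral max.bounded_iff)

lemma fin_supp_mult: "fin_supp f \<Longrightarrow> fin_supp (\<lambda>i. c i * f i)"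
  unfolding fin_supp_def by auto

lemma fin_supp_Suc: "fin_supp f \<Longrightarrow> fin_supp (\<lambda>i. f (Suc i))"
  unfolding fin_supp_def by (meson le_SucI)

lemma fin_supp_up:
  assumes "\<And>s. s \<ge> S \<Longrightarrow> g s = 0"
  shows "fin_supp (\<lambda>i. g (q + int i))"
  unfolding fin_supp_def by (rule exI[of _ "nat (S - q)"]) (auto intro!: assms)

lemma fin_supp_down:
  assumes "\<And>s. s \<le> S \<Longrightarrow> g s = 0"
  shows "fin_supp (\<lambda>i. g (q - int i))"
  unfolding fin_supp_def by (rule exI[of _ "nat (q - S)"]) (auto intro!: assms)

lemma fin_suppI: "(\<And>i. i \<ge> N \<Longrightarrow> h i = 0) \<Longrightarrow> fin_supp h"
  unfolding fin_supp_def by auto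

lemma fin_supp_summable: "fin_supp h \<Longrightarrow> summable h"
proof -
  assume "fin_supp h"
  then obtain N where N: "\<forall>i\<ge>N. h i = 0" unfolding fin_supp_def by auto
  show ?thesis by (rule summable_finite[of "{..<N}"]) (use N in \<open>auto simp: not_less\<close>)
qed

lemma bsum_eq_sum:
  assumes "\<And>i. i \<ge> N \<Longrightarrow> h i = 0"
  shows "bsum n h = (\<Sum>i<N. (of_int n gchoose i) * h i)"
  unfolding bsum_def by (rule suminf_finite) (auto simp: assms not_less)

lemma bsum_nat:
  assumes "n \<ge> 0"
  shows "bsum n h = (\<Sum>i\<le>nat n. (of_int n gchoose i) * h i)"
  unfolding bsum_def
proof (rule suminf_finite)
  fix i assume "i \<notin> {..nat n}"
  hence "nat n < i" by auto
  hence "(of_nat (nat n) :: complex) gchoose i = 0"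
    by (simp add: binomial_gbinomial[symmetric])
  thus "(of_int n gchoose i) * h i = 0" using assms by simp
qed auto

lemma bsum_cong: "(\<And>i. f i = g i) \<Longrightarrow> bsum n f = bsum n g"
  unfolding bsum_def by simp

lemma bsum_zero [simp]: "bsum n (\<lambda>i. 0) = 0"
  unfolding bsum_def by simp

lemma bsum_0 [simp]: "bsum 0 h = h 0"
  by (simp add: bsum_nat)

lemma bsum_add:
  assumes "fin_supp f" "fin_supp g"
  shows "bsum n (\<lambda>i. f i + g i) = bsum n f + bsum n g"
  unfolding bsum_def distrib_left
  by (rule suminf_add[symmetric]) (intro fin_supp_summable fin_supp_mult assms)+

lemma bsum_cmult:
  assumes "fin_supp f"
  shows "bsum n (\<lambda>i. c * f i) = c * bsum n f"
proof -
  have "(\<Sum>i. c * ((of_int n gchoose i) * f i)) = c * (\<Sum>i. (of_int n gchoose i) * f i)"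
    by (rule suminf_mult) (intro fin_supp_summable fin_supp_mult assms)
  thus ?thesis unfolding bsum_def by (simp add: mult.left_commute)
qed

lemma bsum_uminus: "fin_supp f \<Longrightarrow> bsum n (\<lambda>i. - f i) = - bsum n f"
  using bsum_cmult[of f n "-1"] by simp

text \<open>(1 + y)^(n+1) = (1 + y)^n (1 + y). The comparisons of expansions below rest on this rule
  together with one row where they are known to agree.\<close>

lemma bsum_Pascal:
  assumes "fin_supp h"
  shows "bsum (n + 1) h = bsum n h + bsum n (\<lambda>i. h (Suc i))"
proof -
  let ?b = "\<lambda>i. (of_int n :: complex) gchoose i"
  have s: "summable (\<lambda>i. c i * h i)" "summable (\<lambda>i. c i * h (Suc i))" for c :: "nat \<Rightarrow> complex"
    by (intro fin_supp_summable fin_supp_mult assms fin_supp_Suc)+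
  have head: "(\<Sum>i. c i * h i) = c 0 * h 0 + (\<Sum>i. c (Suc i) * h (Suc i))" for c
    using suminf_split_head[OF s(1)[of c]] by simp
  have "bsum (n + 1) h = h 0 + (\<Sum>i. ?b i * h (Suc i) + ?b (Suc i) * h (Suc i))"
    unfolding bsum_def by (subst head) (simp add: gbinomial_Suc_Suc add.commute[of 1] distrib_right)
  also have "(\<Sum>i. ?b i * h (Suc i) + ?b (Suc i) * h (Suc i)) =
      (\<Sum>i. ?b i * h (Suc i)) + (\<Sum>i. ?b (Suc i) * h (Suc i))"
    by (rule suminf_add[symmetric]) (rule s)+
  finally show ?thesis unfolding bsum_def by (subst (2) head) simp
qed

lemma bsum_sum:
  assumes "finite F" "\<And>x. x \<in> F \<Longrightarrow> fin_supp (f x)"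
  shows "bsum n (\<lambda>i. \<Sum>x\<in>F. f x i) = (\<Sum>x\<in>F. bsum n (f x)) \<and> fin_supp (\<lambda>i. \<Sum>x\<in>F. f x i)"
  using assms
proof (induction F rule: finite_induct)
  case empty
  then show ?case by (auto simp: fin_supp_def)
next
  case (insert x F)
  then show ?case by (auto simp: bsum_add intro: fin_supp_add)
qed

text \<open>Symmetry of the binomial coefficients. The generators of J run through descending modes,
  the coefficients of a product with (1 + y)^N through ascending ones.\<close>

lemma bsum_reverse:
  assumes "N \<ge> 0"
  shows "bsum N (\<lambda>j. g (a - int j)) = bsum N (\<lambda>j. g (a - N + int j))"
proof -
  have "(\<Sum>i\<le>nat N. (of_int N gchoose i) * g (a - int i)) =
        (\<Sum>i\<le>nat N. (of_int N gchoose (nat N - i)) * g (a - int (nat N - i)))"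
    by (rule sum.reindex_bij_witness[of _ "\<lambda>i. nat N - i" "\<lambda>i. nat N - i"]) auto
  also have "\<dots> = (\<Sum>i\<le>nat N. (of_int N gchoose i) * g (a - N + int i))"
  proof (rule sum.cong[OF refl])
    fix i assume "i \<in> {..nat N}"
    hence i: "i \<le> nat N" by auto
    have "(of_nat (nat N) :: complex) gchoose (nat N - i) = of_nat (nat N) gchoose i"
      using i by (simp flip: binomial_gbinomial binomial_symmetric)
    moreover have "a - int (nat N - i) = a - N + int i" using i assms by linarith
    ultimately show "(of_int N gchoose (nat N - i)) * g (a - int (nat N - i)) =
        (of_int N gchoose i) * g (a - N + int i)" using assms by (metis of_int_of_nat_eq int_nat_eq)
  qed
  finally show ?thesis using assms by (simp add: bsum_nat)
qed

lemma bsum_swap: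
  assumes "N \<ge> 0" "\<And>j. fin_supp (h j)"
  shows "bsum N (\<lambda>j. bsum M (h j)) = bsum M (\<lambda>i. bsum N (\<lambda>j. h j i))"
proof -
  have "bsum M (\<lambda>i. \<Sum>j\<le>nat N. (of_int N gchoose j) * h j i) =
      (\<Sum>j\<le>nat N. bsum M (\<lambda>i. (of_int N gchoose j) * h j i))"
    by (rule bsum_sum[THEN conjunct1]) (auto intro: fin_supp_mult assms)
  thus ?thesis using assms by (simp add: bsum_nat bsum_cmult)
qed

section \<open>Residues at infinity\<close>

text \<open>With g(y) the sum of g_s y^(-s-1), the \<open>bsum\<close> is the coefficient of
  y^(-s-1) in (1 + y)^N g(y). So this product is a Laurent polynomial of degree at most
  -b-2.\<close>

definition adm :: "int \<Rightarrow> int \<Rightarrow> (int \<Rightarrow> complex) \<Rightarrow> bool" where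
  "adm N b g \<longleftrightarrow> N \<ge> 0 \<and> (\<exists>S. \<forall>s\<ge>S. g s = 0) \<and> (\<forall>s\<le>b. bsum N (\<lambda>j. g (s + int j)) = 0)"

text \<open>For \<open>g(y) = \<Sum>\<^sub>s g\<^sub>s y\<^sup>-\<^sup>s\<^sup>-\<^sup>1\<close> such that \<open>(1 + y)\<^sup>N g(y)\<close> is a Laurent polynomial, \<open>res N g q n\<close> is the
coefficient of \<open>y\<^sup>-\<^sup>1\<close> in the expansion at infinity of \<open>y\<^sup>q (1 + y)\<^sup>n g(y)\<close>.\<close>

definition res :: "int \<Rightarrow> (int \<Rightarrow> complex) \<Rightarrow> int \<Rightarrow> int \<Rightarrow> complex" where
  "res N g q n = bsum (n - N) (\<lambda>i. bsum N (\<lambda>j. g (q + n - N - int i + int j)))"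

lemma adm_fin_supp: "adm N b g \<Longrightarrow> fin_supp (\<lambda>j. g (s + int j))"
  unfolding adm_def using fin_supp_up by metis

lemma adm_fin_supp_outer: "adm N b g \<Longrightarrow> fin_supp (\<lambda>i. bsum N (\<lambda>j. g (s - int i + int j)))"
  unfolding adm_def using fin_supp_down[of b "\<lambda>s. bsum N (\<lambda>j. g (s + int j))"] by auto

lemma adm_mono: "adm N b g \<Longrightarrow> b' \<le> b \<Longrightarrow> adm N b' g"
  unfolding adm_def by auto

lemma adm_cmult:
  assumes "adm N b f"
  shows "adm N b (\<lambda>s. c * f s)"
proof -
  have "bsum N (\<lambda>j. c * f (s + int j)) = 0" if "s \<le> b" for s
    using assms that bsum_cmult[OF assms[THEN adm_fin_supp]] by (simp add: adm_def)
  thus ?thesis using assms unfolding adm_def by (metis mult_zero_right)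
qed

lemma res_zero [simp]: "res N (\<lambda>s. 0) q n = 0"
  unfolding res_def by simp

lemma res_add:
  assumes "adm N b f" "adm N b g"
  shows "res N (\<lambda>s. f s + g s) q n = res N f q n + res N g q n"
  unfolding res_def using assms
  by (simp add: bsum_add adm_fin_supp adm_fin_supp_outer)

lemma res_cmult:
  assumes "adm N b f"
  shows "res N (\<lambda>s. c * f s) q n = c * res N f q n"
  unfolding res_def using assms
  by (simp add: bsum_cmult adm_fin_supp adm_fin_supp_outer)

lemma res_Pascal:
  assumes "adm N b g"
  shows "res N g q (n + 1) = res N g (q + 1) n + res N g q n"
proof -
  let ?h = "\<lambda>i. bsum N (\<lambda>j. g (q + n - N + 1 - int i + int j))"
  have "res N g q (n + 1) = bsum (n - N + 1) ?h"
    unfolding res_def by (simp add: algebra_simps)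
  also have "\<dots> = bsum (n - N) ?h + bsum (n - N) (\<lambda>i. ?h (Suc i))"
    using assms by (intro bsum_Pascal adm_fin_supp_outer)
  finally show ?thesis unfolding res_def by (simp add: algebra_simps)
qed

text \<open>The factor (1 + y)^N g(y) has degree at most -b-2, so the expansion at infinity has
  degree at most q+n-N-b-2 \<le> -2 and contains no y^(-1).\<close>

lemma res_vanish:
  assumes "adm N b g" "q + n - N \<le> b"
  shows "res N g q n = 0"
proof -
  have "bsum N (\<lambda>j. g (q + n - N - int i + int j)) = 0" for i
    using assms unfolding adm_def by auto
  thus ?thesis unfolding res_def by simp
qed

text \<open>For n \<ge> N the factor (1 + y)^(n-N) is a polynomial, so its expansions at zero and at
  infinity agree.\<close>

lemma res_polynomial:
  assumes "adm N b g" "n \<ge> N"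
  shows "res N g q n = bsum n (\<lambda>j. g (q + int j))"
proof -
  have "res N g q (N + int k) = bsum (N + int k) (\<lambda>j. g (q + int j))" for k q
  proof (induction k arbitrary: q)
    case 0
    then show ?case by (simp add: res_def)
  next
    case (Suc k)
    have "res N g q (N + int (Suc k)) = res N g (q + 1) (N + int k) + res N g q (N + int k)"
      using res_Pascal[OF assms(1), of q "N + int k"] by (simp add: algebra_simps)
    also have "\<dots> = bsum (N + int k + 1) (\<lambda>j. g (q + int j))"
      using assms(1) by (subst bsum_Pascal) (simp_all add: Suc adm_fin_supp algebra_simps)
    finally show ?case by (simp add: algebra_simps)
  qed
  from this[of q "nat (n - N)"] show ?thesis using assms by simp
qed

text \<open>Upwards from row \<open>n0\<close> the rule determines the rows outright. Downwards it
  is a recursion in \<open>q\<close>, started on the diagonal q + n = b, where \<open>f\<close>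
  vanishes.\<close>

lemma Pascal_unique:
  fixes f :: "int \<Rightarrow> int \<Rightarrow> complex"
  assumes P: "\<And>q n. f q (n + 1) = f (q + 1) n + f q n"
    and V: "\<And>q n. q + n \<le> b \<Longrightarrow> f q n = 0"
    and base: "\<And>q. f q n0 = 0"
  shows "f q n = 0"
proof (cases "n \<ge> n0")
  case True
  have "f q (n0 + int k) = 0" for k q
  proof (induction k arbitrary: q)
    case (Suc k)
    then show ?case using P[of q "n0 + int k"] by (simp add: algebra_simps)
  qed (simp add: base)
  from this[of q "nat (n - n0)"] True show ?thesis by simp
next
  case False
  have "f q (n0 - int k) = 0" for k q
  proof (induction k arbitrary: q)
    case (Suc k)
    have "f (b - (n0 - int (Suc k)) + int j) (n0 - int (Suc k)) = 0" for j
    proof (induction j)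
      case 0
      show ?case by (rule V) simp
    next
      case (Suc j)
      have "f (b - (n0 - int (Suc k)) + int j) (n0 - int k) = 0"
        using \<open>\<And>q. f q (n0 - int k) = 0\<close> .
      with Suc P[of "b - (n0 - int (Suc k)) + int j" "n0 - int (Suc k)"] show ?case
        by (simp add: algebra_simps)
    qed
    from this[of "nat (q - (b - (n0 - int (Suc k))))"] show ?case
      by (cases "q + (n0 - int (Suc k)) \<le> b") (simp add: V, simp)
  qed (simp add: base)
  from this[of q "nat (n0 - n)"] False show ?thesis by simp
qed

section \<open>Three-point functions\<close>

text \<open>The three sides of the Jacobi identity paired with \<open>x\<^sub>0\<^sup>r x\<^sub>1\<^sup>p x\<^sub>2\<^sup>q (1 + x\<^sub>1)\<^sup>m (1 + x\<^sub>2)\<^sup>n\<close>, where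
\<open>x\<^sub>0 = x\<^sub>1 - x\<^sub>2\<close>. For \<open>QC\<close> the powers of \<open>x\<^sub>1 = x\<^sub>2 + x\<^sub>0\<close> and of \<open>1 + x\<^sub>1 = (1 + x\<^sub>2) + x\<^sub>0\<close> are expanded in \<open>x\<^sub>0\<close>.\<close>

definition QA :: "(int \<Rightarrow> int \<Rightarrow> int \<Rightarrow> int \<Rightarrow> complex) \<Rightarrow> int \<Rightarrow> int \<Rightarrow> int \<Rightarrow> int \<Rightarrow> int \<Rightarrow> complex" where
  "QA a r p q m n = bsum r (\<lambda>i. (-1) ^ i * a (p + r - int i) (q + int i) m n)"

definition QB :: "(int \<Rightarrow> int \<Rightarrow> int \<Rightarrow> int \<Rightarrow> complex) \<Rightarrow> int \<Rightarrow> int \<Rightarrow> int \<Rightarrow> int \<Rightarrow> int \<Rightarrow> complex" where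
  "QB b r p q m n = sgnpow r * bsum r (\<lambda>i. (-1) ^ i * b (p + int i) (q + r - int i) m n)"

definition QC :: "(int \<Rightarrow> int \<Rightarrow> int \<Rightarrow> complex) \<Rightarrow> int \<Rightarrow> int \<Rightarrow> int \<Rightarrow> int \<Rightarrow> int \<Rightarrow> complex" where
  "QC W r p q m n =
     bsum p (\<lambda>i. bsum m (\<lambda>j. W (r + int i + int j) (p + q - int i) (m + n - int j)))"

text \<open>An array entry \<open>a p q m n\<close> stands for a pairing with x_1^p x_2^q (1 +
  x_1)^m (1 + x_2)^n; the two rules express multiplication by 1 + x_1 and by 1 + x_2.\<close>

definition Pascal1 :: "(int \<Rightarrow> int \<Rightarrow> int \<Rightarrow> int \<Rightarrow> complex) \<Rightarrow> bool" where
  "Pascal1 a \<longleftrightarrow> (\<forall>p q m n. a p q (m + 1) n = a (p + 1) q m n + a p q m n)"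

definition Pascal2 :: "(int \<Rightarrow> int \<Rightarrow> int \<Rightarrow> int \<Rightarrow> complex) \<Rightarrow> bool" where
  "Pascal2 a \<longleftrightarrow> (\<forall>p q m n. a p q m (n + 1) = a p (q + 1) m n + a p q m n)"

text \<open>Expanding x_0^r into monomials in x_1 and x_2 only shifts \<open>p\<close> and
  \<open>q\<close>, which commutes with multiplication by 1 + x_1 or 1 + x_2; finite support lets
  the sum be split.\<close>

lemma QA_Pascal:
  assumes f: "\<And>p q m n. fin_supp (\<lambda>i. a (p - int i) (q + int i) m n)"
  shows "Pascal1 a \<Longrightarrow> Pascal1 (QA a r)" "Pascal2 a \<Longrightarrow> Pascal2 (QA a r)"
proof -
  assume P: "Pascal1 a"
  have e: "a (p + r - int i) (q + int i) (m + 1) n =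
      a (p + 1 + r - int i) (q + int i) m n + a (p + r - int i) (q + int i) m n" for p q m n i
    using P[unfolded Pascal1_def, rule_format, of "p + r - int i" "q + int i" m n]
    by (simp add: algebra_simps)
  show "Pascal1 (QA a r)" unfolding Pascal1_def QA_def e distrib_left
    by (intro allI bsum_add fin_supp_mult f)
next
  assume P: "Pascal2 a"
  have e: "a (p + r - int i) (q + int i) m (n + 1) =
      a (p + r - int i) (q + 1 + int i) m n + a (p + r - int i) (q + int i) m n" for p q m n i
    using P[unfolded Pascal2_def, rule_format, of "p + r - int i" "q + int i" m n]
    by (simp add: algebra_simps)
  show "Pascal2 (QA a r)" unfolding Pascal2_def QA_def e distrib_left
    by (intro allI bsum_add fin_supp_mult f)
qed

lemma QB_Pascal:
  assumes f: "\<And>p q m n. fin_supp (\<lambda>i. b (p + int i) (q - int i) m n)"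
  shows "Pascal1 b \<Longrightarrow> Pascal1 (QB b r)" "Pascal2 b \<Longrightarrow> Pascal2 (QB b r)"
proof -
  assume P: "Pascal1 b"
  have e: "b (p + int i) (q + r - int i) (m + 1) n =
      b (p + 1 + int i) (q + r - int i) m n + b (p + int i) (q + r - int i) m n" for p q m n i
    using P[unfolded Pascal1_def, rule_format, of "p + int i" "q + r - int i" m n]
    by (simp add: algebra_simps)
  show "Pascal1 (QB b r)" unfolding Pascal1_def QB_def e distrib_left
    by (simp add: bsum_add fin_supp_mult f distrib_left)
next
  assume P: "Pascal2 b"
  have e: "b (p + int i) (q + r - int i) m (n + 1) =
      b (p + int i) (q + 1 + r - int i) m n + b (p + int i) (q + r - int i) m n" for p q m n i
    using P[unfolded Pascal2_def, rule_format, of "p + int i" "q + r - int i" m n]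
    by (simp add: algebra_simps)
  show "Pascal2 (QB b r)" unfolding Pascal2_def QB_def e distrib_left
    by (simp add: bsum_add fin_supp_mult f distrib_left)
qed

lemma Pascal_diff:
  "Pascal1 a \<Longrightarrow> Pascal1 b \<Longrightarrow> Pascal1 (\<lambda>p q m n. a p q m n - b p q m n)"
  "Pascal2 a \<Longrightarrow> Pascal2 b \<Longrightarrow> Pascal2 (\<lambda>p q m n. a p q m n - b p q m n)"
  unfolding Pascal1_def Pascal2_def by simp_all

lemma Pascal_upward:
  assumes "Pascal1 a" "Pascal2 a" "\<And>p q. a p q 0 0 = 0" "m \<ge> 0" "n \<ge> 0"
  shows "a p q m n = 0"
proof -
  have 1: "a p q (int x) 0 = 0" for x p q
  proof (induction x arbitrary: p q)
    case (Suc x)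
    then show ?case using assms(1)[unfolded Pascal1_def, rule_format, of p q "int x" 0]
      by (simp add: add.commute)
  qed (simp add: assms)
  have "a p q (int x) (int y) = 0" for x y p q
  proof (induction y arbitrary: p q)
    case (Suc y)
    then show ?case using assms(2)[unfolded Pascal2_def, rule_format, of p q "int x" "int y"]
      by (simp add: add.commute)
  qed (simp add: 1)
  from this[of p q "nat m" "nat n"] assms show ?thesis by simp
qed

lemma Pascal_unique2:
  assumes P: "Pascal1 a" "Pascal2 a" and V: "\<And>p q m n. p + q + m + n \<le> b \<Longrightarrow> a p q m n = 0"
    and base: "\<And>p q. a p q m0 n0 = 0"
  shows "a p q m n = 0"
proof -
  note 1 = P(1)[unfolded Pascal1_def, rule_format] and 2 = P(2)[unfolded Pascal2_def, rule_format]
  have row: "a p q m n0 = 0" for p q m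
  proof (rule Pascal_unique[where f = "\<lambda>p m. a p q m n0" and b = "b - q - n0" and ?n0.0 = m0])
    show "a p q m n0 = 0" if "p + m \<le> b - q - n0" for p m using that by (intro V) simp
  qed (rule 1 base)+
  show ?thesis
  proof (rule Pascal_unique[where f = "\<lambda>q n. a p q m n" and b = "b - p - m" and ?n0.0 = n0])
    show "a p q m n = 0" if "q + n \<le> b - p - m" for q n using that by (intro V) simp
  qed (rule 2 row)+
qed

lemma QC_Pascal:
  assumes W: "\<And>r q n. W r q (n + 1) = W r (q + 1) n + W r q n"
    and R: "\<And>r q n. r \<ge> R \<Longrightarrow> W r q n = 0"
  shows "Pascal1 (QC W r)" "Pascal2 (QC W r)"
proof -
  have fj: "fin_supp (\<lambda>j. W (r' + int j) (f j) (g j))" for r' f g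
    by (rule fin_suppI[of "nat (R - r')"]) (auto intro!: R)
  have fi: "fin_supp (\<lambda>i. bsum m (\<lambda>j. W (r' + int i + int j) (f i j) (g i j)))" for r' m f g
  proof (rule fin_suppI[of "nat (R - r')"])
    fix i assume "nat (R - r') \<le> i"
    hence "\<And>j. W (r' + int i + int j) (f i j) (g i j) = 0" by (intro R) auto
    thus "bsum m (\<lambda>j. W (r' + int i + int j) (f i j) (g i j)) = 0" by simp
  qed
  show "Pascal1 (QC W r)" unfolding Pascal1_def
  proof (intro allI)
    fix p q m n
    \<comment> \<open>\<open>?X 1\<close>, \<open>?X 0\<close> and \<open>?Z\<close> carry an extra
      factor x_2, 1 and x_0. The factor 1 + x_1 = (1 + x_2) + x_0 produces all three, the factor x_1
      = x_2 + x_0 only \<open>?X 1\<close> and \<open>?Z\<close>.\<close>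
    let ?X = "\<lambda>a i j. W (r + int i + int j) (p + q - int i + a) (m + n - int j)"
    let ?Z = "\<lambda>i j. W (r + 1 + int i + int j) (p + q - int i) (m + n - int j)"
    have "QC W r p q (m + 1) n =
      bsum p (\<lambda>i. bsum (m + 1) (\<lambda>j. W (r + int i + int j) (p + q - int i) (m + 1 + n - int j)))"
      unfolding QC_def ..
    also have "\<dots> = bsum p (\<lambda>i. bsum m (\<lambda>j. ?X 1 i j) + bsum m (\<lambda>j. ?X 0 i j) + bsum m (\<lambda>j. ?Z i j))"
    proof (rule bsum_cong)
      fix i
      have e: "W (r + int i + int j) (p + q - int i) (m + 1 + n - int j) = ?X 1 i j + ?X 0 i j" for j
        using W[of "r + int i + int j" "p + q - int i" "m + n - int j"] by (simp add: algebra_simps)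
      have "bsum (m + 1) (\<lambda>j. W (r + int i + int j) (p + q - int i) (m + 1 + n - int j)) =
        bsum m (\<lambda>j. W (r + int i + int j) (p + q - int i) (m + 1 + n - int j)) +
        bsum m (\<lambda>j. W (r + int i + int (Suc j)) (p + q - int i) (m + 1 + n - int (Suc j)))"
        by (rule bsum_Pascal) (rule fj)
      also have "bsum m (\<lambda>j. W (r + int i + int (Suc j)) (p + q - int i) (m + 1 + n - int (Suc j)))
        = bsum m (\<lambda>j. ?Z i j)" by (simp add: algebra_simps)
      finally show "bsum (m + 1) (\<lambda>j. W (r + int i + int j) (p + q - int i) (m + 1 + n - int j)) =
        bsum m (\<lambda>j. ?X 1 i j) + bsum m (\<lambda>j. ?X 0 i j) + bsum m (\<lambda>j. ?Z i j)"
        unfolding e by (simp only: bsum_add[OF fj fj])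
    qed
    also have "\<dots> = bsum p (\<lambda>i. bsum m (\<lambda>j. ?X 1 i j)) + bsum p (\<lambda>i. bsum m (\<lambda>j. ?X 0 i j))
        + bsum p (\<lambda>i. bsum m (\<lambda>j. ?Z i j))"
      by (simp only: bsum_add[OF fin_supp_add[OF fi fi] fi] bsum_add[OF fi fi])
    also have "bsum p (\<lambda>i. bsum m (\<lambda>j. ?X 0 i j)) = QC W r p q m n"
      unfolding QC_def by simp
    also have "bsum p (\<lambda>i. bsum m (\<lambda>j. ?X 1 i j)) + QC W r p q m n + bsum p (\<lambda>i. bsum m (\<lambda>j. ?Z i j))
      = QC W r (p + 1) q m n + QC W r p q m n"
    proof -
      have "QC W r (p + 1) q m n =
        bsum p (\<lambda>i. bsum m (\<lambda>j. W (r + int i + int j) (p + 1 + q - int i) (m + n - int j))) +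
        bsum p (\<lambda>i. bsum m (\<lambda>j. W (r + int (Suc i) + int j) (p + 1 + q - int (Suc i)) (m + n - int j)))"
        unfolding QC_def by (rule bsum_Pascal) (rule fi)
      also have "bsum p (\<lambda>i. bsum m (\<lambda>j. W (r + int (Suc i) + int j) (p + 1 + q - int (Suc i)) (m + n - int j)))
        = bsum p (\<lambda>i. bsum m (\<lambda>j. ?Z i j))" by (simp add: algebra_simps)
      finally show ?thesis by (simp add: algebra_simps)
    qed
    finally show "QC W r p q (m + 1) n = QC W r (p + 1) q m n + QC W r p q m n" .
  qed
  show "Pascal2 (QC W r)" unfolding Pascal2_def
  proof (intro allI)
    fix p q m n
    have e: "W r' (p + q - i) (m + (n + 1) - j) =
       W r' (p + (q + 1) - i) (m + n - j) + W r' (p + q - i) (m + n - j)" for r' i j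
      using W[of r' "p + q - i" "m + n - j"] by (simp add: algebra_simps)
    show "QC W r p q m (n + 1) = QC W r p (q + 1) m n + QC W r p q m n"
      unfolding QC_def e by (simp only: bsum_add[OF fj fj] bsum_add[OF fi fi])
  qed
qed

text \<open>The arrays are the coefficients of the three expansions \<open>A = \<phi>(Y(c,x\<^sub>1)Y(u,x\<^sub>2)v)\<close>,
\<open>B = \<phi>(Y(u,x\<^sub>2)Y(c,x\<^sub>1)v)\<close> and \<open>C = \<phi>(Y(Y(c,x\<^sub>0)u,x\<^sub>2)v)\<close> of a three-point function, where
\<open>c\<close> and \<open>u\<close> have weights \<open>k\<close> and \<open>l\<close>.\<close>

locale three_point =
  fixes A B C :: "int \<Rightarrow> int \<Rightarrow> complex" and d k l T :: int
  assumes nonneg: "d \<ge> 0" "k \<ge> 0" "l \<ge> 0"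
    and jacobi: "\<And>p q r. bsum p (\<lambda>i. C (r + int i) (p + q - int i)) =
        bsum r (\<lambda>i. (-1) ^ i * A (p + r - int i) (q + int i)) -
        sgnpow r * bsum r (\<lambda>i. (-1) ^ i * B (p + int i) (q + r - int i))"
    and A_trunc: "\<And>s t. t \<ge> T \<Longrightarrow> A s t = 0"
    and B_trunc: "\<And>s t. s \<ge> T \<Longrightarrow> B s t = 0"
    and C_trunc: "\<And>r t. r \<ge> k + l \<Longrightarrow> C r t = 0"
    and A_adm: "\<And>t. adm (k + d) (- d - 2) (\<lambda>s. A s t)"
    and B_adm: "\<And>s. adm (l + d) (- d - 2) (\<lambda>t. B s t)"
    and C_adm: "\<And>r. r < k + l \<Longrightarrow> adm (k + l - r - 1 + d) (- d - 2) (\<lambda>t. C r t)"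
begin

lemma C_fin: "fin_supp (\<lambda>j. C r (s + int j))"
proof (cases "r < k + l")
  case True
  then show ?thesis using C_adm adm_fin_supp by blast
next
  case False
  then show ?thesis by (simp add: C_trunc fin_supp_def)
qed

text \<open>Powers of 1 + x_1 and 1 + x_2 are expanded at zero here. The inner sum is over the
  variable whose truncation bound depends on the other; the outer variable is truncated uniformly at
  \<open>T\<close>.\<close>

definition Af where "Af p q m n = bsum n (\<lambda>j. bsum m (\<lambda>i. A (p + int i) (q + int j)))"
definition Bf where "Bf p q m n = bsum m (\<lambda>i. bsum n (\<lambda>j. B (p + int i) (q + int j)))"
definition Cf where "Cf r q n = bsum n (\<lambda>j. C r (q + int j))"

lemma Af_trunc: "q \<ge> T \<Longrightarrow> Af p q m n = 0"
  unfolding Af_def using A_trunc by simp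

lemma Bf_trunc: "p \<ge> T \<Longrightarrow> Bf p q m n = 0"
  unfolding Bf_def using B_trunc by simp

lemma Af_Pascal: "Pascal1 Af" "Pascal2 Af"
proof -
  have f1: "fin_supp (\<lambda>i. A (p + int i) t)" for p t using A_adm adm_fin_supp by blast
  have f2: "fin_supp (\<lambda>j. bsum m (\<lambda>i. A (f i) (q + int j)))" for f q m
    by (rule fin_supp_up[of T "\<lambda>t. bsum m (\<lambda>i. A (f i) t)"]) (simp add: A_trunc)
  show "Pascal1 Af" unfolding Pascal1_def Af_def bsum_Pascal[OF f1] bsum_add[OF f2 f2]
    by (simp add: algebra_simps)
  show "Pascal2 Af" unfolding Pascal2_def Af_def bsum_Pascal[OF f2]
    by (simp add: algebra_simps)
qed

lemma Bf_Pascal: "Pascal1 Bf" "Pascal2 Bf"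
proof -
  have f1: "fin_supp (\<lambda>j. B s (q + int j))" for s q using B_adm adm_fin_supp by blast
  have f2: "fin_supp (\<lambda>i. bsum n (\<lambda>j. B (p + int i) (f j)))" for p f n
    by (rule fin_supp_up[of T "\<lambda>t. bsum n (\<lambda>j. B t (f j))"]) (simp add: B_trunc)
  show "Pascal1 Bf" unfolding Pascal1_def Bf_def bsum_Pascal[OF f2]
    by (simp add: algebra_simps)
  show "Pascal2 Bf" unfolding Pascal2_def Bf_def bsum_Pascal[OF f1] bsum_add[OF f2 f2]
    by (simp add: algebra_simps)
qed

text \<open>At m = n = 0 this is the Jacobi identity; multiplying by 1 + x_1 and 1 + x_2 carries it
  to all nonnegative exponents.\<close>

lemma jacobi_polynomial:
  assumes "m \<ge> 0" "n \<ge> 0"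
  shows "QA Af r p q m n - QB Bf r p q m n = QC Cf r p q m n"
proof -
  have fA: "fin_supp (\<lambda>i. Af (p - int i) (q + int i) m n)" for p q m n
    by (rule fin_suppI[of "nat (T - q)"]) (auto intro!: Af_trunc)
  have fB: "fin_supp (\<lambda>i. Bf (p + int i) (q - int i) m n)" for p q m n
    by (rule fin_suppI[of "nat (T - p)"]) (auto intro!: Bf_trunc)
  have C1: "Cf r q (n + 1) = Cf r (q + 1) n + Cf r q n" for r q n
    unfolding Cf_def bsum_Pascal[OF C_fin] by (simp add: algebra_simps)
  have C2: "Cf r q n = 0" if "r \<ge> k + l" for r q n
    unfolding Cf_def using C_trunc that by simp
  have "QA Af r p q m n - QB Bf r p q m n - QC Cf r p q m n = 0"
  proof (rule Pascal_upward[of "\<lambda>p q m n. QA Af r p q m n - QB Bf r p q m n - QC Cf r p q m n"])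
    show "Pascal1 (\<lambda>p q m n. QA Af r p q m n - QB Bf r p q m n - QC Cf r p q m n)"
      by (intro Pascal_diff QA_Pascal QB_Pascal QC_Pascal[of Cf, OF C1 C2] Af_Pascal Bf_Pascal fA fB)
    show "Pascal2 (\<lambda>p q m n. QA Af r p q m n - QB Bf r p q m n - QC Cf r p q m n)"
      by (intro Pascal_diff QA_Pascal QB_Pascal QC_Pascal[of Cf, OF C1 C2] Af_Pascal Bf_Pascal fA fB)
    show "QA Af r p q 0 0 - QB Bf r p q 0 0 - QC Cf r p q 0 0 = 0" for p q
      using jacobi[of p r q] by (simp add: QA_def QB_def QC_def Af_def Bf_def Cf_def)
  qed (use assms in auto)
  thus ?thesis by simp
qed

section \<open>Three-point functions expanded at infinity\<close>

definition Ar where "Ar p q m n = res (l + d) (\<lambda>t. res (k + d) (\<lambda>s. A s t) p m) q n"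
definition Br where "Br p q m n = res (k + d) (\<lambda>s. res (l + d) (\<lambda>t. B s t) q n) p m"
definition Cr where "Cr r q n = res (k + l - r - 1 + d) (\<lambda>t. C r t) q n"

lemma Cr_trunc: "r \<ge> k + l \<Longrightarrow> Cr r q n = 0"
proof -
  assume "r \<ge> k + l"
  hence "C r = (\<lambda>_. 0)" using C_trunc by auto
  thus ?thesis unfolding Cr_def by simp
qed

lemma Cr_Pascal: "Cr r q (n + 1) = Cr r (q + 1) n + Cr r q n"
proof (cases "r < k + l")
  case True
  then show ?thesis unfolding Cr_def by (rule res_Pascal[OF C_adm])
qed (simp add: Cr_trunc)

lemma Cr_vanish: "r + q + n \<le> k + l - 3 \<Longrightarrow> Cr r q n = 0"
proof (cases "r < k + l")
  case True
  then show "r + q + n \<le> k + l - 3 \<Longrightarrow> Cr r q n = 0"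
    unfolding Cr_def by (intro res_vanish[OF C_adm]) auto
qed (simp add: Cr_trunc)

lemma QC_Cr_vanish: "p + q + m + n + r \<le> k + l - 3 \<Longrightarrow> QC Cr r p q m n = 0"
proof -
  assume "p + q + m + n + r \<le> k + l - 3"
  hence "Cr (r + int i + int j) (p + q - int i) (m + n - int j) = 0" for i j
    by (intro Cr_vanish) auto
  thus ?thesis unfolding QC_def by simp
qed

text \<open>The term with indices \<open>i\<close>, \<open>j\<close> needs an exponent of at least
  k+l-(r+i+j)-1+d and has m+n-j, so the bound at i = j = 0 suffices for all terms.\<close>

lemma QC_Cf_eq_Cr:
  assumes "m + n \<ge> k + l - r - 1 + d"
  shows "QC Cf r p q m n = QC Cr r p q m n"
proof -
  have "Cf (r + int i + int j) q (m + n - int j) = Cr (r + int i + int j) q (m + n - int j)" for i j q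
  proof (cases "r + int i + int j < k + l")
    case True
    then show ?thesis
      unfolding Cf_def Cr_def using assms by (intro res_polynomial[OF C_adm, symmetric]) auto
  qed (simp add: Cr_trunc Cf_def C_trunc)
  thus ?thesis unfolding QC_def by simp
qed

text \<open>In low total degree the commutator has no contribution, so the two orders agree; and one of
them vanishes.\<close>

lemma Af_Bf_vanish:
  assumes "a + b \<le> - 2 * d - 3"
  shows "Af a b (k + d) (l + d) = 0" "Bf a b (k + d) (l + d) = 0"
proof -
  have "Af a b (k + d) (l + d) - Bf a b (k + d) (l + d) = QC Cr 0 a b (k + d) (l + d)"
    using jacobi_polynomial[of "k + d" "l + d" 0 a b] QC_Cf_eq_Cr[of 0 "k + d" "l + d" a b] nonneg
    by (simp add: QA_def QB_def sgnpow_def)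
  also have "\<dots> = 0" using assms by (intro QC_Cr_vanish) auto
  finally have e: "Af a b (k + d) (l + d) = Bf a b (k + d) (l + d)" by simp
  have "Af a b (k + d) (l + d) = 0 \<and> Bf a b (k + d) (l + d) = 0"
  \<comment> \<open>If a \<ge> -d-1, the assumption forces b \<le> -d-2, so admissibility applies to
    \<open>A\<close> in x_1 or to \<open>B\<close> in x_2.\<close>
  proof (cases "a \<le> - d - 2")
    case True
    then show ?thesis using A_adm e unfolding Af_def adm_def by simp
  next
    case False
    then show ?thesis using B_adm e assms unfolding Bf_def adm_def by simp
  qed
  thus "Af a b (k + d) (l + d) = 0" "Bf a b (k + d) (l + d) = 0" by auto
qed

text \<open>Exchanging the sums leaves coefficients of (1 + x_1)^(k+d) (1 + x_2)^(l+d) A in total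
  degree above 2d. This yields the relations of J, the cut-off in relation (3), and the
  admissibility of the inner residue as a function of \<open>t\<close>.\<close>

lemma A_total_vanish:
  assumes "p + m + q \<le> k - d - 3"
  shows "bsum (l + d) (\<lambda>j. res (k + d) (\<lambda>s. A s (q + int j)) p m) = 0"
proof -
  have "bsum (l + d) (\<lambda>j. res (k + d) (\<lambda>s. A s (q + int j)) p m) =
     bsum (m - (k + d)) (\<lambda>i. Af (p + m - (k + d) - int i) q (k + d) (l + d))"
    unfolding res_def Af_def using nonneg
    by (intro bsum_swap adm_fin_supp_outer[OF A_adm]) auto
  also have "\<dots> = 0" using assms by (simp add: Af_Bf_vanish)
  finally show ?thesis .
qed

lemma B_total_vanish:
  assumes "p + q + n \<le> l - d - 3"
  shows "bsum (k + d) (\<lambda>i. res (l + d) (\<lambda>t. B (p + int i) t) q n) = 0"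
proof -
  have "bsum (k + d) (\<lambda>i. res (l + d) (\<lambda>t. B (p + int i) t) q n) =
     bsum (n - (l + d)) (\<lambda>j. Bf p (q + n - (l + d) - int j) (k + d) (l + d))"
    unfolding res_def Bf_def using nonneg
    by (intro bsum_swap adm_fin_supp_outer[OF B_adm]) auto
  also have "\<dots> = 0" using assms by (simp add: Af_Bf_vanish)
  finally show ?thesis .
qed

text \<open>This gives the outer residue in \<open>Ar\<close> its meaning: times (1 + x_2)^(l+d),
  the inner residue is a Laurent polynomial in x_2.\<close>

lemma Ar_adm: "adm (l + d) (k - d - 3 - p - m) (\<lambda>t. res (k + d) (\<lambda>s. A s t) p m)"
  unfolding adm_def using nonneg A_total_vanish A_trunc
  by (auto intro!: exI[of _ T])

lemma Br_adm: "adm (k + d) (l - d - 3 - q - n) (\<lambda>s. res (l + d) (\<lambda>t. B s t) q n)"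
proof -
  have "B s = (\<lambda>_. 0)" if "s \<ge> T" for s using B_trunc[OF that] by auto
  thus ?thesis unfolding adm_def using nonneg B_total_vanish by (auto intro!: exI[of _ T])
qed

lemma Ar_Pascal: "Pascal1 Ar" "Pascal2 Ar"
proof -
  \<comment> \<open>The bounds of \<open>Ar_adm\<close> for \<open>p\<close> and
    \<open>p + 1\<close> differ by one; \<open>res_add\<close> needs a common one, hence the
    smaller.\<close>
  have a: "adm (l + d) (k - d - 4 - p - m) (\<lambda>t. res (k + d) (\<lambda>s. A s t) p m)"
    "adm (l + d) (k - d - 4 - p - m) (\<lambda>t. res (k + d) (\<lambda>s. A s t) (p + 1) m)" for p m
    by (rule adm_mono[OF Ar_adm], simp)+
  show "Pascal1 Ar" unfolding Pascal1_def Ar_def res_Pascal[OF A_adm]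
    using res_add[OF a(2) a(1)] by blast
  show "Pascal2 Ar" unfolding Pascal2_def Ar_def using res_Pascal[OF Ar_adm] by blast
qed

lemma Br_Pascal: "Pascal1 Br" "Pascal2 Br"
proof -
  have a: "adm (k + d) (l - d - 4 - q - n) (\<lambda>s. res (l + d) (\<lambda>t. B s t) q n)"
    "adm (k + d) (l - d - 4 - q - n) (\<lambda>s. res (l + d) (\<lambda>t. B s t) (q + 1) n)" for q n
    by (rule adm_mono[OF Br_adm], simp)+
  show "Pascal2 Br" unfolding Pascal2_def Br_def res_Pascal[OF B_adm]
    using res_add[OF a(2) a(1)] by blast
  show "Pascal1 Br" unfolding Pascal1_def Br_def using res_Pascal[OF Br_adm] by blast
qed

lemma Ar_vanish1: "p + m \<le> k - 2 \<Longrightarrow> Ar p q m n = 0"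
  unfolding Ar_def by (subst res_vanish[OF A_adm]) auto

lemma Br_vanish2: "q + n \<le> l - 2 \<Longrightarrow> Br p q m n = 0"
  unfolding Br_def by (subst res_vanish[OF B_adm]) auto

lemma Ar_vanish: "p + q + m + n \<le> k + l - 3 \<Longrightarrow> Ar p q m n = 0"
  unfolding Ar_def by (rule res_vanish[OF Ar_adm]) auto

lemma Br_vanish: "p + q + m + n \<le> k + l - 3 \<Longrightarrow> Br p q m n = 0"
  unfolding Br_def by (rule res_vanish[OF Br_adm]) auto

lemma Ar_fin: "fin_supp (\<lambda>i. Ar (p - int i) (q + int i) m n)"
  by (rule fin_suppI[of "nat (p + m - k + 2)"]) (auto intro!: Ar_vanish1)

lemma Br_fin: "fin_supp (\<lambda>i. Br (p + int i) (q - int i) m n)"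
  by (rule fin_suppI[of "nat (q + n - l + 2)"]) (auto intro!: Br_vanish2)

lemma Ar_eq_Af: "m \<ge> k + d \<Longrightarrow> n \<ge> l + d \<Longrightarrow> Ar p q m n = Af p q m n"
  unfolding Ar_def Af_def
  by (subst res_polynomial[OF Ar_adm], simp) (subst res_polynomial[OF A_adm], simp_all)

lemma Br_eq_Bf: "m \<ge> k + d \<Longrightarrow> n \<ge> l + d \<Longrightarrow> Br p q m n = Bf p q m n"
  unfolding Br_def Bf_def
  by (subst res_polynomial[OF Br_adm], simp) (subst res_polynomial[OF B_adm], simp_all)

text \<open>Unlike in \<open>jacobi_polynomial\<close>, negative powers of \<open>1 + x\<^sub>i\<close> occur and are expanded at infinity.
Both sides obey Pascal's rule and vanish in low total degree, so they agree as they do for large \<open>m\<close>, \<open>n\<close>.\<close>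

lemma jacobi_residue: "QA Ar r p q m n - QB Br r p q m n = QC Cr r p q m n"
proof -
  let ?D = "\<lambda>p q m n. QA Ar r p q m n - QB Br r p q m n - QC Cr r p q m n"
  \<comment> \<open>Large enough both for \<open>Br_eq_Bf\<close>, which needs n \<ge> l+d, and for
    \<open>QC_Cf_eq_Cr\<close>, where m+n has to absorb \<open>- r\<close> when \<open>r\<close> is
    negative.\<close>
  let ?n0 = "l + d + max 0 (- r)"
  have "?D p q m n = 0"
  proof (rule Pascal_unique2[of ?D "k + l - 3 - r" "k + d" ?n0])
    show "Pascal1 ?D"
      by (intro Pascal_diff QA_Pascal QB_Pascal QC_Pascal[of Cr, OF Cr_Pascal Cr_trunc]
          Ar_Pascal Br_Pascal Ar_fin Br_fin)
    show "Pascal2 ?D"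
      by (intro Pascal_diff QA_Pascal QB_Pascal QC_Pascal[of Cr, OF Cr_Pascal Cr_trunc]
          Ar_Pascal Br_Pascal Ar_fin Br_fin)
    show "?D p q m n = 0" if "p + q + m + n \<le> k + l - 3 - r" for p q m n
    proof -
      have "Ar (p + r - int i) (q + int i) m n = 0" for i using that by (intro Ar_vanish) auto
      moreover have "Br (p + int i) (q + r - int i) m n = 0" for i using that by (intro Br_vanish) auto
      ultimately show ?thesis using that by (simp add: QA_def QB_def QC_Cr_vanish)
    qed
    show "?D p q (k + d) ?n0 = 0" for p q
      using jacobi_polynomial[of "k + d" ?n0 r p q] QC_Cf_eq_Cr[of r "k + d" ?n0 p q] nonneg
      by (simp add: QA_def QB_def Ar_eq_Af Br_eq_Bf)
  qed
  thus ?thesis by simp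
qed

text \<open>The value on \<open>c\<^sub>r u\<close> of the matrix coefficient \<open>v(q)\<phi>\<close>, when the latter has degree \<open>D\<close>.\<close>

definition psi :: "int \<Rightarrow> int \<Rightarrow> complex" where
  "psi D r = Cr r 0 (D + k + l - r - 2)"

text \<open>The sum is the \<open>QC\<close> side of the residue Jacobi identity at p = q = 0. For n
  \<ge> k+D the exponents of x_2 and 1 + x_2 add up to at most l-2, so the \<open>QB\<close> side
  vanishes.\<close>

lemma psi_sum:
  assumes "n \<ge> k + D"
  shows "bsum n (\<lambda>j. psi D (a + int j)) = QA Ar a 0 0 n (D + k + l - 2 - a - n)"
proof -
  have "Br (int i) (a - int i) n (D + k + l - 2 - a - n) = 0" for i
    using assms by (intro Br_vanish2) auto
  hence "QB Br a 0 0 n (D + k + l - 2 - a - n) = 0" unfolding QB_def by simp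
  hence "QA Ar a 0 0 n (D + k + l - 2 - a - n) = QC Cr a 0 0 n (D + k + l - 2 - a - n)"
    using jacobi_residue[of a 0 0 n "D + k + l - 2 - a - n"] by simp
  thus ?thesis unfolding QC_def psi_def by (simp add: algebra_simps)
qed

lemma QA_vanish: "a + n \<le> k - 2 \<Longrightarrow> QA Ar a 0 0 n n' = 0"
proof -
  assume "a + n \<le> k - 2"
  hence "Ar (a - int i) (int i) n n' = 0" for i by (intro Ar_vanish1) auto
  thus ?thesis unfolding QA_def by simp
qed

lemma psi_adm:
  assumes "D \<ge> 0"
  shows "adm (k + D) (- D - 2) (psi D)"
proof -
  have "psi D s = 0" if "s \<ge> k + l" for s unfolding psi_def by (rule Cr_trunc[OF that])
  moreover have "bsum (k + D) (\<lambda>j. psi D (s + int j)) = 0" if "s \<le> - D - 2" for s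
    using that by (subst psi_sum) (auto intro: QA_vanish)
  ultimately show ?thesis unfolding adm_def using assms nonneg by auto
qed

text \<open>Extends \<open>psi_sum\<close> to every \<open>n\<close>: both sides obey Pascal's rule,
  vanish for q+n \<le> k-2 and agree in the row n = k+D.\<close>

lemma psi_res:
  assumes "D \<ge> 0"
  shows "res (k + D) (psi D) q n = QA Ar q 0 0 n (D + k + l - 2 - q - n)"
proof -
  let ?h = "\<lambda>q n. QA Ar q 0 0 n (D + k + l - 2 - q - n)"
  have "res (k + D) (psi D) q n - ?h q n = 0"
  proof (rule Pascal_unique[of "\<lambda>q n. res (k + D) (psi D) q n - ?h q n" "k - 2" "k + D"])
    fix q n
    show "res (k + D) (psi D) q n - ?h q n = 0" if "q + n \<le> k - 2"
      using that by (subst res_vanish[OF psi_adm[OF assms]]) (auto simp: QA_vanish)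
    show "res (k + D) (psi D) q (k + D) - ?h q (k + D) = 0"
      by (subst res_polynomial[OF psi_adm[OF assms]]) (simp_all add: psi_sum)
    \<comment> \<open>Pascal's rule for \<open>?h\<close> is 1 + x_1 = (x_1 - x_2) + (1 + x_2).
      \<open>?F x y\<close> carries the extra factor x_1^x x_2^y, and \<open>?n\<close> is the
      exponent of 1 + x_2 common to the three terms.\<close>
    let ?n = "D + k + l - 3 - q - n"
    let ?F = "\<lambda>x y i. (-1) ^ i * Ar (q + x - int i) (y + int i) n ?n"
    have f: "fin_supp (?F x y)" for x y by (intro fin_supp_mult Ar_fin)
    have "?h q (n + 1) = bsum q (\<lambda>i. ?F 1 0 i + ?F 0 0 i)"
      unfolding QA_def
    proof (rule bsum_cong)
      fix i
      have "Ar (0 + q - int i) (0 + int i) (n + 1) ?n =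
        Ar (0 + q - int i + 1) (0 + int i) n ?n + Ar (0 + q - int i) (0 + int i) n ?n"
        using Ar_Pascal(1) unfolding Pascal1_def by blast
      moreover have "?n = D + k + l - 2 - q - (n + 1)" by simp
      ultimately show "(-1) ^ i * Ar (0 + q - int i) (0 + int i) (n + 1) (D + k + l - 2 - q - (n + 1)) =
         ?F 1 0 i + ?F 0 0 i" by (simp add: algebra_simps)
    qed
    hence 1: "?h q (n + 1) = bsum q (?F 1 0) + bsum q (?F 0 0)" by (simp only: bsum_add[OF f f])
    have "?h (q + 1) n = bsum (q + 1) (?F 1 0)"
      unfolding QA_def by (intro bsum_cong) (simp add: algebra_simps)
    also have "\<dots> = bsum q (?F 1 0) + bsum q (\<lambda>i. ?F 1 0 (Suc i))" by (rule bsum_Pascal[OF f])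
    also have "(\<lambda>i. ?F 1 0 (Suc i)) = (\<lambda>i. - ?F 0 1 i)" by simp
    finally have 2: "?h (q + 1) n = bsum q (?F 1 0) - bsum q (?F 0 1)" by (simp only: bsum_uminus[OF f]) simp
    have "?h q n = bsum q (\<lambda>i. ?F 0 1 i + ?F 0 0 i)"
      unfolding QA_def
    proof (rule bsum_cong)
      fix i
      have "Ar (0 + q - int i) (0 + int i) n (?n + 1) =
        Ar (0 + q - int i) (0 + int i + 1) n ?n + Ar (0 + q - int i) (0 + int i) n ?n"
        using Ar_Pascal(2) unfolding Pascal2_def by blast
      moreover have "?n + 1 = D + k + l - 2 - q - n" by simp
      ultimately show "(-1) ^ i * Ar (0 + q - int i) (0 + int i) n (D + k + l - 2 - q - n) =
         ?F 0 1 i + ?F 0 0 i" by (simp add: algebra_simps)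
    qed
    hence 3: "?h q n = bsum q (?F 0 1) + bsum q (?F 0 0)" by (simp only: bsum_add[OF f f])
    show "res (k + D) (psi D) q (n + 1) - ?h q (n + 1) =
      res (k + D) (psi D) (q + 1) n - ?h (q + 1) n + (res (k + D) (psi D) q n - ?h q n)"
      unfolding 1 2 3 res_Pascal[OF psi_adm[OF assms]] by simp
  qed
  thus ?thesis by simp
qed

text \<open>At q = 0 the kernel (x_1 - x_2)^q is 1, so acting by two modes in succession is a single
  iterated residue of \<open>A\<close>.\<close>

lemma psi_res_product:
  assumes "D \<ge> 0"
  shows "res (k + D) (psi D) 0 (k + D + l - p - 2) = Ar 0 0 (k + D + l - p - 2) p"
  using psi_res[OF assms, of 0 "k + D + l - p - 2"] by (simp add: QA_def)

end

section \<open>Matrix coefficients over a graded vertex algebra\<close>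

lemma fsum_eq_sum:
  assumes "\<And>i. i \<ge> N \<Longrightarrow> f i = 0"
  shows "fsum f = (\<Sum>i<N. f i)"
  unfolding fsum_def
  by (rule sum.mono_neutral_left) (use assms in \<open>auto simp: not_less[symmetric]\<close>)

lemma sum_int_eq_bsum:
  assumes "N \<ge> 0"
  shows "(\<Sum>j\<in>{0..N}. (of_int N gchoose nat j) * f j) = bsum N (\<lambda>j. f (int j))"
  unfolding bsum_nat[OF assms]
  by (rule sum.reindex_bij_witness[of _ int nat]) (use assms in auto)

locale graded_va =
  fixes sV :: "complex \<Rightarrow> 'v::ab_group_add \<Rightarrow> 'v"
    and Y :: "'v \<Rightarrow> int \<Rightarrow> 'v \<Rightarrow> 'v"
    and vac :: 'v
    and Vg :: "int \<Rightarrow> 'v set"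
  assumes VA: "N_graded_VA sV Y vac Vg"
begin

lemma VA_props:
  shows vs: "Vector_Spaces.vector_space sV"
    and Y_left: "Y (sV a u + u') n v = sV a (Y u n v) + Y u' n v"
    and Y_right: "Y u n (sV a v + v') = sV a (Y u n v) + Y u n v'"
    and borcherds: "fsum (\<lambda>i. sV ((of_int p) gchoose i) (Y (Y u (r + int i) v) (p + q - int i) w)) =
        fsum (\<lambda>i. sV ((-1) ^ i * ((of_int r) gchoose i))
                     (Y u (p + r - int i) (Y v (q + int i) w)
                      - sV (sgnpow r) (Y v (q + r - int i) (Y u (p + int i) w))))"
proof -
  note va = VA[unfolded N_graded_VA_def vertex_algebra_def bilinear_Y_def, THEN conjunct1]
  show "Vector_Spaces.vector_space sV" by (rule va[THEN conjunct1])
  show "Y (sV a u + u') n v = sV a (Y u n v) + Y u' n v"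
    by (rule va[THEN conjunct2, THEN conjunct1, THEN conjunct1, rule_format])
  show "Y u n (sV a v + v') = sV a (Y u n v) + Y u n v'"
    by (rule va[THEN conjunct2, THEN conjunct1, THEN conjunct2, rule_format])
  show "fsum (\<lambda>i. sV ((of_int p) gchoose i) (Y (Y u (r + int i) v) (p + q - int i) w)) =
        fsum (\<lambda>i. sV ((-1) ^ i * ((of_int r) gchoose i))
                     (Y u (p + r - int i) (Y v (q + int i) w)
                      - sV (sgnpow r) (Y v (q + r - int i) (Y u (p + int i) w))))"
    by (rule va[THEN conjunct2, THEN conjunct2, THEN conjunct2, THEN conjunct2, THEN conjunct2,
          rule_format])
qed

sublocale V: vector_space sV by (rule vs)

lemma Vg_0: "0 \<in> Vg n"
  and Vg_add: "x \<in> Vg n \<Longrightarrow> y \<in> Vg n \<Longrightarrow> x + y \<in> Vg n"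
  and Vg_scale: "x \<in> Vg n \<Longrightarrow> sV a x \<in> Vg n"
  and Vg_neg: "n < 0 \<Longrightarrow> x \<in> Vg n \<Longrightarrow> x = 0"
  and Vg_Y: "u \<in> Vg k \<Longrightarrow> v \<in> Vg l \<Longrightarrow> Y u m v \<in> Vg (k + l - m - 1)"
  and Vg_decomp: "\<exists>F c. finite F \<and> (\<forall>n\<in>F. c n \<in> Vg n) \<and> v = sum c F"
proof -
  note gr = VA[unfolded N_graded_VA_def, THEN conjunct2]
  have "subsp sV (Vg n)" by (rule gr[THEN conjunct1, rule_format])
  thus "0 \<in> Vg n" "x \<in> Vg n \<Longrightarrow> y \<in> Vg n \<Longrightarrow> x + y \<in> Vg n" "x \<in> Vg n \<Longrightarrow> sV a x \<in> Vg n"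
    unfolding subsp_def by blast+
  show "n < 0 \<Longrightarrow> x \<in> Vg n \<Longrightarrow> x = 0"
    using gr[THEN conjunct2, THEN conjunct1] by blast
  show "\<exists>F c. finite F \<and> (\<forall>n\<in>F. c n \<in> Vg n) \<and> v = sum c F"
    by (rule gr[THEN conjunct2, THEN conjunct2, THEN conjunct1, rule_format])
  show "u \<in> Vg k \<Longrightarrow> v \<in> Vg l \<Longrightarrow> Y u m v \<in> Vg (k + l - m - 1)"
    by (rule gr[THEN conjunct2, THEN conjunct2, THEN conjunct2, THEN conjunct2, rule_format])
qed

lemma Vg_diff: "x \<in> Vg n \<Longrightarrow> y \<in> Vg n \<Longrightarrow> x - y \<in> Vg n"
  using Vg_add[of x n "sV (-1) y"] Vg_scale[of y n "-1"] by simp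

lemma Y_zero_left [simp]: "Y 0 n v = 0" and Y_zero_right [simp]: "Y u n 0 = 0"
  using Y_left[of 1 0 0 n v] Y_right[of u n 1 0 0] by auto

lemma Y_neg: "k < 0 \<or> l < 0 \<Longrightarrow> c \<in> Vg k \<Longrightarrow> b \<in> Vg l \<Longrightarrow> Y c s b = 0"
  using Vg_neg[of k c] Vg_neg[of l b] by auto

lemma Y_trunc: "c \<in> Vg k \<Longrightarrow> b \<in> Vg l \<Longrightarrow> s \<ge> k + l \<Longrightarrow> Y c s b = 0"
  using Vg_neg[OF _ Vg_Y[of c k b l s]] by auto

text \<open>A vector \<open>x\<close> of degree \<open>d\<close> in a module with lowest degree part \<open>M\<close>, together with a linear
form on \<open>M\<close>, gives the family \<open>\<phi> k c = c(k - 1 + d) x\<close> for \<open>c\<close> of weight \<open>k\<close>. The second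
condition says that \<open>(1 + y)\<^sup>k\<^sup>+\<^sup>d \<phi>(Y(c,y)b)\<close> is a Laurent polynomial of degree at most \<open>d\<close>;
for \<open>d = 0\<close> it is the vanishing on Zhu's \<open>O(V)\<close>.\<close>

definition matcoeff :: "int \<Rightarrow> (int \<Rightarrow> 'v \<Rightarrow> complex) \<Rightarrow> bool" where
  "matcoeff d \<phi> \<longleftrightarrow>
     (\<forall>k a x y. x \<in> Vg k \<longrightarrow> y \<in> Vg k \<longrightarrow> \<phi> k (sV a x + y) = a * \<phi> k x + \<phi> k y) \<and>
     (\<forall>k l c b s. c \<in> Vg k \<longrightarrow> b \<in> Vg l \<longrightarrow> s \<le> - d - 2 \<longrightarrow>
        bsum (k + d) (\<lambda>j. \<phi> (k + l - (s + int j) - 1) (Y c (s + int j) b)) = 0) \<and>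
     (d < 0 \<longrightarrow> (\<forall>k. \<forall>x\<in>Vg k. \<phi> k x = 0))"

text \<open>The formula is relation (3) for c(k-1+D) u(m) x, where D = d+n-m-1 is the degree of
  u(m)x: the upper entry p-k-d of its first binomial becomes n-m-2, and each term (c_s u)(...)x is
  the value of \<phi> on c_s u.\<close>

definition mode :: "int \<Rightarrow> int \<Rightarrow> 'v \<Rightarrow> int \<Rightarrow> (int \<Rightarrow> 'v \<Rightarrow> complex) \<Rightarrow> int \<Rightarrow> 'v \<Rightarrow> complex" where
  "mode d n u m \<phi> = (\<lambda>k c. res (k + d) (\<lambda>s. \<phi> (k + n - s - 1) (Y c s u)) 0 (k + n + d - m - 2))"

context
  fixes d \<phi>
  assumes \<phi>: "matcoeff d \<phi>"
begin

lemma mc_lin: "x \<in> Vg k \<Longrightarrow> y \<in> Vg k \<Longrightarrow> \<phi> k (sV a x + y) = a * \<phi> k x + \<phi> k y"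
  using \<phi> unfolding matcoeff_def by blast

lemma mc_0 [simp]: "\<phi> k 0 = 0"
  using mc_lin[OF Vg_0 Vg_0, of k 1] by simp

lemma mc_add: "x \<in> Vg k \<Longrightarrow> y \<in> Vg k \<Longrightarrow> \<phi> k (x + y) = \<phi> k x + \<phi> k y"
  using mc_lin[of x k y 1] by simp

lemma mc_scale: "x \<in> Vg k \<Longrightarrow> \<phi> k (sV a x) = a * \<phi> k x"
  using mc_lin[of x k 0 a] Vg_0 by simp

lemma mc_diff: "x \<in> Vg k \<Longrightarrow> y \<in> Vg k \<Longrightarrow> \<phi> k (x - y) = \<phi> k x - \<phi> k y"
  using mc_lin[of y k x "-1"] by simp

lemma mc_sum:
  assumes "finite F" "\<And>i. i \<in> F \<Longrightarrow> x i \<in> Vg k"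
  shows "\<phi> k (sum x F) = (\<Sum>i\<in>F. \<phi> k (x i)) \<and> sum x F \<in> Vg k"
  using assms by (induction F rule: finite_induct) (auto simp: mc_add Vg_0 intro: Vg_add)

lemma mc_trivial: "d < 0 \<or> k < 0 \<Longrightarrow> c \<in> Vg k \<Longrightarrow> b \<in> Vg l \<Longrightarrow> \<phi> (k + l - s - 1) (Y c s b) = 0"
  using \<phi> Vg_Y[of c k b l s] Vg_neg[of k c] unfolding matcoeff_def by auto

lemma mc_adm:
  assumes "d \<ge> 0" "k \<ge> 0" "c \<in> Vg k" "b \<in> Vg l"
  shows "adm (k + d) (- d - 2) (\<lambda>s. \<phi> (k + l - s - 1) (Y c s b))"
  unfolding adm_def
proof (intro conjI allI impI exI[of _ "k + l"])
  show "\<phi> (k + l - s - 1) (Y c s b) = 0" if "k + l \<le> s" for s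
    using Y_trunc[OF assms(3,4) that] by simp
qed (use assms \<phi> in \<open>auto simp: matcoeff_def\<close>)

lemma mode_trivial: "d < 0 \<or> k < 0 \<Longrightarrow> c \<in> Vg k \<Longrightarrow> u \<in> Vg n \<Longrightarrow> mode d n u m \<phi> k c = 0"
  unfolding mode_def by (simp add: mc_trivial)

text \<open>Relation (1): besides (1 + y)^(k+d) the exponent n-m-2 \<le> -d-2 remains, too low for a
  residue.\<close>

lemma mode_vanish:
  assumes "d + n - m - 1 < 0" "c \<in> Vg k" "u \<in> Vg n"
  shows "mode d n u m \<phi> k c = 0"
proof (cases "d < 0 \<or> k < 0")
  case False
  then show ?thesis unfolding mode_def using assms by (intro res_vanish[OF mc_adm]) auto
qed (use mode_trivial assms in auto)

lemma mc_jacobi: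
  fixes p q r :: int
  assumes "c \<in> Vg k" "u \<in> Vg l" "v \<in> Vg h"
  defines "w \<equiv> k + l + h - p - q - r - 2"
  shows "bsum p (\<lambda>i. \<phi> w (Y (Y c (r + int i) u) (p + q - int i) v)) =
        bsum r (\<lambda>i. (-1) ^ i * \<phi> w (Y c (p + r - int i) (Y u (q + int i) v))) -
        sgnpow r * bsum r (\<lambda>i. (-1) ^ i * \<phi> w (Y u (q + r - int i) (Y c (p + int i) v)))"
proof -
  let ?C = "\<lambda>i. Y (Y c (r + int i) u) (p + q - int i) v"
  let ?A = "\<lambda>i. Y c (p + r - int i) (Y u (q + int i) v)"
  let ?B = "\<lambda>i. Y u (q + r - int i) (Y c (p + int i) v)"
  have g: "?C i \<in> Vg w" "?A i \<in> Vg w" "?B i \<in> Vg w" for i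
    using Vg_Y[OF Vg_Y[OF assms(1,2), of "r + int i"] assms(3), of "p + q - int i"]
      Vg_Y[OF assms(1) Vg_Y[OF assms(2,3), of "q + int i"], of "p + r - int i"]
      Vg_Y[OF assms(2) Vg_Y[OF assms(1,3), of "p + int i"], of "q + r - int i"]
    unfolding w_def by (simp_all add: algebra_simps)
  \<comment> \<open>Past \<open>N\<close> all three inner products vanish, so both sides become
    finite sums over one range, to which \<phi> applies termwise.\<close>
  define N where "N = nat (max (k + l - r) (max (l + h - q) (k + h - p)))"
  have z: "?C i = 0" "?A i = 0" "?B i = 0" if "i \<ge> N" for i
    using that Y_trunc[OF assms(1,2), of "r + int i"] Y_trunc[OF assms(2,3), of "q + int i"]
      Y_trunc[OF assms(1,3), of "p + int i"] unfolding N_def by auto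
  have 1: "(\<Sum>i<N. sV (of_int p gchoose i) (?C i)) =
      (\<Sum>i<N. sV ((-1) ^ i * (of_int r gchoose i)) (?A i - sV (sgnpow r) (?B i)))"
  proof -
    have "fsum (\<lambda>i. sV (of_int p gchoose i) (?C i)) = (\<Sum>i<N. sV (of_int p gchoose i) (?C i))"
      by (rule fsum_eq_sum) (simp add: z)
    moreover have "fsum (\<lambda>i. sV ((-1) ^ i * (of_int r gchoose i)) (?A i - sV (sgnpow r) (?B i))) =
      (\<Sum>i<N. sV ((-1) ^ i * (of_int r gchoose i)) (?A i - sV (sgnpow r) (?B i)))"
      by (rule fsum_eq_sum) (simp add: z)
    ultimately show ?thesis using borcherds[of p c r u q v] by simp
  qed
  have "\<phi> w (\<Sum>i<N. sV (of_int p gchoose i) (?C i)) = (\<Sum>i<N. (of_int p gchoose i) * \<phi> w (?C i))"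
    using mc_sum[of "{..<N}" "\<lambda>i. sV (of_int p gchoose i) (?C i)" w]
    by (simp only: mc_scale[OF g(1)] Vg_scale[OF g(1)] finite_lessThan)
  moreover have "\<phi> w (\<Sum>i<N. sV ((-1) ^ i * (of_int r gchoose i)) (?A i - sV (sgnpow r) (?B i))) =
     (\<Sum>i<N. ((-1) ^ i * (of_int r gchoose i)) * (\<phi> w (?A i) - sgnpow r * \<phi> w (?B i)))"
    using mc_sum[of "{..<N}" "\<lambda>i. sV ((-1) ^ i * (of_int r gchoose i)) (?A i - sV (sgnpow r) (?B i))" w]
    by (simp only: mc_scale[OF Vg_diff[OF g(2) Vg_scale[OF g(3)]]] mc_diff[OF g(2) Vg_scale[OF g(3)]]
        mc_scale[OF g(3)] Vg_scale[OF Vg_diff[OF g(2) Vg_scale[OF g(3)]]] finite_lessThan)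
  moreover have "bsum p (\<lambda>i. \<phi> w (?C i)) = (\<Sum>i<N. (of_int p gchoose i) * \<phi> w (?C i))"
    by (rule bsum_eq_sum) (simp add: z)
  moreover have "bsum r (\<lambda>i. (-1) ^ i * \<phi> w (?A i)) = (\<Sum>i<N. (of_int r gchoose i) * ((-1) ^ i * \<phi> w (?A i)))"
    by (rule bsum_eq_sum) (simp add: z)
  moreover have "bsum r (\<lambda>i. (-1) ^ i * \<phi> w (?B i)) = (\<Sum>i<N. (of_int r gchoose i) * ((-1) ^ i * \<phi> w (?B i)))"
    by (rule bsum_eq_sum) (simp add: z)
  moreover have "(\<Sum>i<N. ((-1) ^ i * (of_int r gchoose i)) * (\<phi> w (?A i) - sgnpow r * \<phi> w (?B i))) =
      (\<Sum>i<N. (of_int r gchoose i) * ((-1) ^ i * \<phi> w (?A i))) -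
      sgnpow r * (\<Sum>i<N. (of_int r gchoose i) * ((-1) ^ i * \<phi> w (?B i)))"
    unfolding sum_distrib_left sum_subtractf[symmetric]
    by (intro sum.cong refl) (simp add: algebra_simps)
  ultimately show ?thesis using 1 by simp
qed

text \<open>Each admissibility is the defining condition of \<phi> for the outer vector, with the
  inner product as the other one; for \<open>C\<close> the outer vector is c_r u, of weight
  k+l-r-1.\<close>

lemma mc_three_point:
  assumes "d \<ge> 0" "k \<ge> 0" "l \<ge> 0" "c \<in> Vg k" "u \<in> Vg l" "v \<in> Vg h"
  shows "three_point (\<lambda>s t. \<phi> (k + (l + h - t - 1) - s - 1) (Y c s (Y u t v)))
     (\<lambda>s t. \<phi> (l + (k + h - s - 1) - t - 1) (Y u t (Y c s v)))
     (\<lambda>r t. \<phi> (k + l - r - 1 + h - t - 1) (Y (Y c r u) t v)) d k l (max k l + h)"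
proof
  fix p q r
  show "bsum p (\<lambda>i. \<phi> (k + l - (r + int i) - 1 + h - (p + q - int i) - 1) (Y (Y c (r + int i) u) (p + q - int i) v)) =
        bsum r (\<lambda>i. (-1) ^ i * \<phi> (k + (l + h - (q + int i) - 1) - (p + r - int i) - 1) (Y c (p + r - int i) (Y u (q + int i) v))) -
        sgnpow r * bsum r (\<lambda>i. (-1) ^ i * \<phi> (l + (k + h - (p + int i) - 1) - (q + r - int i) - 1) (Y u (q + r - int i) (Y c (p + int i) v)))"
    using mc_jacobi[OF assms(4-6), of p q r] by (simp add: algebra_simps)
next
  fix s t assume "max k l + h \<le> t"
  thus "\<phi> (k + (l + h - t - 1) - s - 1) (Y c s (Y u t v)) = 0"
    using Y_trunc[OF assms(5,6), of t] by simp
next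
  fix s t assume "max k l + h \<le> s"
  thus "\<phi> (l + (k + h - s - 1) - t - 1) (Y u t (Y c s v)) = 0"
    using Y_trunc[OF assms(4,6), of s] by simp
next
  fix r t assume "k + l \<le> r"
  thus "\<phi> (k + l - r - 1 + h - t - 1) (Y (Y c r u) t v) = 0"
    using Y_trunc[OF assms(4,5), of r] by simp
next
  show "adm (k + d) (- d - 2) (\<lambda>s. \<phi> (k + (l + h - t - 1) - s - 1) (Y c s (Y u t v)))" for t
    by (rule mc_adm) (use assms Vg_Y in auto)
  show "adm (l + d) (- d - 2) (\<lambda>t. \<phi> (l + (k + h - s - 1) - t - 1) (Y u t (Y c s v)))" for s
    by (rule mc_adm) (use assms Vg_Y in auto)
  show "adm (k + l - r - 1 + d) (- d - 2) (\<lambda>t. \<phi> (k + l - r - 1 + h - t - 1) (Y (Y c r u) t v))"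
    if "r < k + l" for r
    by (rule mc_adm) (use that assms Vg_Y in auto)
qed (use assms in auto)

text \<open>The value of v(m)\<phi> on c_r b is \<open>psi\<close> of a three-point function, so
  stability is \<open>psi_adm\<close>. Negative weights or degrees, excluded from
  \<open>three_point\<close>, give zero.\<close>

lemma mode_matcoeff:
  assumes v: "v \<in> Vg h"
  shows "matcoeff (d + h - m - 1) (mode d h v m \<phi>)"
proof -
  let ?D = "d + h - m - 1"
  have lin: "mode d h v m \<phi> k (sV a x + y) = a * mode d h v m \<phi> k x + mode d h v m \<phi> k y"
    if "x \<in> Vg k" "y \<in> Vg k" for k a x y
  proof (cases "d < 0 \<or> k < 0")
    case True
    then show ?thesis using that v by (simp add: mode_trivial Vg_add Vg_scale)
  next
    case False
    have e: "\<phi> (k + h - s - 1) (Y (sV a x + y) s v) =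
        a * \<phi> (k + h - s - 1) (Y x s v) + \<phi> (k + h - s - 1) (Y y s v)" for s
      using that v by (simp add: Y_left mc_lin Vg_Y)
    have "adm (k + d) (- d - 2) (\<lambda>s. \<phi> (k + h - s - 1) (Y x s v))"
      "adm (k + d) (- d - 2) (\<lambda>s. \<phi> (k + h - s - 1) (Y y s v))"
      using False that v by (auto intro!: mc_adm)
    thus ?thesis unfolding mode_def e
      by (simp add: res_add[OF adm_cmult] res_cmult)
  qed
  moreover have "bsum (k + ?D) (\<lambda>j. mode d h v m \<phi> (k + l - (s + int j) - 1) (Y c (s + int j) b)) = 0"
    if c: "c \<in> Vg k" and b: "b \<in> Vg l" and s: "s \<le> - ?D - 2" for k l c b s
  proof (cases "d < 0 \<or> ?D < 0")
    case True
    then show ?thesis using Vg_Y[OF c b] v by (auto simp: mode_trivial mode_vanish)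
  next
    case False
    show ?thesis
    proof (cases "k < 0 \<or> l < 0")
      case True
      hence "Y c t b = 0" for t using c b by (rule Y_neg)
      hence "mode d h v m \<phi> k' (Y c t b) = 0" for k' t
        unfolding mode_def by simp
      thus ?thesis by simp
    next
      case False2: False
      interpret three_point "\<lambda>s t. \<phi> (k + (l + h - t - 1) - s - 1) (Y c s (Y b t v))"
         "\<lambda>s t. \<phi> (l + (k + h - s - 1) - t - 1) (Y b t (Y c s v))"
         "\<lambda>r t. \<phi> (k + l - r - 1 + h - t - 1) (Y (Y c r b) t v)" d k l "max k l + h"
        using False False2 c b v by (intro mc_three_point) auto
      have "mode d h v m \<phi> (k + l - r - 1) (Y c r b) = psi ?D r" for r
        unfolding mode_def psi_def Cr_def by (simp add: algebra_simps)
      thus ?thesis using psi_adm[of ?D] False s unfolding adm_def by simp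
    qed
  qed
  moreover have "mode d h v m \<phi> k x = 0" if "?D < 0" "x \<in> Vg k" for k x
    using that v by (simp add: mode_vanish)
  ultimately show ?thesis unfolding matcoeff_def by blast
qed

text \<open>Relation (3): the left side is an iterated residue by \<open>psi_res_product\<close>,
  and its expansion at infinity in x_2 is the double sum on the right.\<close>

lemma mode_product:
  assumes u: "u \<in> Vg l" and v: "v \<in> Vg h" and c: "c \<in> Vg k" and D: "h + d > q"
  shows "mode (d + h - q - 1) l u p (mode d h v q \<phi>) k c =
    (\<Sum>i<nat (h + d - q). \<Sum>j\<in>{0..l + d}.
       (of_int (p - l - d) gchoose i) * (of_int (l + d) gchoose nat j) *
       mode d (l + h - (p - l - d - int i + j) - 1) (Y u (p - l - d - int i + j) v)
         (q + l + d + int i - j) \<phi> k c)"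
proof (cases "d < 0 \<or> k < 0 \<or> l < 0")
  case True
  have "mode (d + h - q - 1) l u p (mode d h v q \<phi>) k c = 0"
  proof (cases "k < 0 \<or> l < 0")
    case True
    hence "Y c s u = 0" for s using c u by (rule Y_neg)
    thus ?thesis unfolding mode_def by simp
  next
    case False
    hence "mode d h v q \<phi> (k + l - s - 1) (Y c s u) = 0" for s
      using True v Vg_Y[OF c u] by (simp add: mode_trivial)
    thus ?thesis unfolding mode_def[of "d + h - q - 1"] by simp
  qed
  moreover have "mode d (l + h - t - 1) (Y u t v) m \<phi> k c = 0" for t m
  proof (cases "d < 0 \<or> k < 0")
    case False
    hence "u = 0" using True u Vg_neg by auto
    then show ?thesis unfolding mode_def by simp
  qed (use c Vg_Y[OF u v] mode_trivial in auto)
  ultimately show ?thesis by (simp only: mult_zero_right sum.neutral_const)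
next
  case False
  let ?D = "d + h - q - 1"
  let ?n = "k + ?D + l - p - 2"
  interpret three_point "\<lambda>s t. \<phi> (k + (l + h - t - 1) - s - 1) (Y c s (Y u t v))"
     "\<lambda>s t. \<phi> (l + (k + h - s - 1) - t - 1) (Y u t (Y c s v))"
     "\<lambda>r t. \<phi> (k + l - r - 1 + h - t - 1) (Y (Y c r u) t v)" d k l "max k l + h"
    using False c u v by (intro mc_three_point) auto
  let ?g = "\<lambda>t. mode d (l + h - t - 1) (Y u t v) (q + p - t) \<phi> k c"
  have g: "?g t = res (k + d) (\<lambda>s. \<phi> (k + (l + h - t - 1) - s - 1) (Y c s (Y u t v))) 0 ?n" for t
    unfolding mode_def by (simp add: algebra_simps)
  have "mode d h v q \<phi> (k + l - r - 1) (Y c r u) = psi ?D r" for r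
    unfolding mode_def psi_def Cr_def by (simp add: algebra_simps)
  hence "mode ?D l u p (mode d h v q \<phi>) k c = res (k + ?D) (psi ?D) 0 ?n"
    unfolding mode_def[of ?D] by (simp add: algebra_simps)
  also have "\<dots> = Ar 0 0 ?n p" using D by (intro psi_res_product) auto
  also have "\<dots> = bsum (p - (l + d)) (\<lambda>i. bsum (l + d) (\<lambda>j. ?g (p - (l + d) - int i + int j)))"
    unfolding Ar_def res_def[of "l + d"] g by simp
  also have "\<dots> = (\<Sum>i<nat (h + d - q). (of_int (p - (l + d)) gchoose i) *
      bsum (l + d) (\<lambda>j. ?g (p - (l + d) - int i + int j)))"
    unfolding g by (rule bsum_eq_sum) (rule A_total_vanish, auto)
  \<comment> \<open>For i \<ge> h+d-q the three exponents add up to at most k-d-3, where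
    \<open>A_total_vanish\<close> applies.\<close>
  also have "\<dots> = (\<Sum>i<nat (h + d - q). (of_int (p - (l + d)) gchoose i) *
      (\<Sum>j\<in>{0..l + d}. (of_int (l + d) gchoose nat j) * ?g (p - (l + d) - int i + j)))"
    using False by (subst sum_int_eq_bsum) auto
  finally show ?thesis by (simp add: sum_distrib_left algebra_simps)
qed

text \<open>The relations of J: reversing \<open>j\<close> gives an inner sum of the shape in
  relation (3), with \<open>i\<close> at or past the cut-off, so \<open>A_total_vanish\<close>
  applies.\<close>

lemma mode_iterate_vanish:
  assumes u: "u \<in> Vg l" and v: "v \<in> Vg h" and c: "c \<in> Vg k" and i: "i \<ge> h + d - q"
  shows "(\<Sum>j\<in>{0..l + d}. (of_int (l + d) gchoose nat j) *
       mode d (l + h - (p - i - j) - 1) (Y u (p - i - j) v) (q + i + j) \<phi> k c) = 0"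
proof (cases "d < 0 \<or> k < 0 \<or> l < 0")
  case True
  have "mode d (l + h - t - 1) (Y u t v) m \<phi> k c = 0" for t m
  proof (cases "d < 0 \<or> k < 0")
    case False
    hence "u = 0" using True u Vg_neg by auto
    then show ?thesis unfolding mode_def by simp
  qed (use c Vg_Y[OF u v] mode_trivial in auto)
  thus ?thesis by simp
next
  case False
  interpret three_point "\<lambda>s t. \<phi> (k + (l + h - t - 1) - s - 1) (Y c s (Y u t v))"
     "\<lambda>s t. \<phi> (l + (k + h - s - 1) - t - 1) (Y u t (Y c s v))"
     "\<lambda>r t. \<phi> (k + l - r - 1 + h - t - 1) (Y (Y c r u) t v)" d k l "max k l + h"
    using False c u v by (intro mc_three_point) auto
  let ?n = "k + l + h + d - p - q - 3"
  let ?g = "\<lambda>t. res (k + d) (\<lambda>s. \<phi> (k + (l + h - t - 1) - s - 1) (Y c s (Y u t v))) 0 ?n"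
  have "mode d (l + h - (p - i - j) - 1) (Y u (p - i - j) v) (q + i + j) \<phi> k c = ?g (p - i - j)" for j
    unfolding mode_def by (simp add: algebra_simps)
  hence "(\<Sum>j\<in>{0..l + d}. (of_int (l + d) gchoose nat j) *
       mode d (l + h - (p - i - j) - 1) (Y u (p - i - j) v) (q + i + j) \<phi> k c) =
       bsum (l + d) (\<lambda>j. ?g (p - i - int j))"
    using False sum_int_eq_bsum[of "l + d" "\<lambda>j. ?g (p - i - j)"] by simp
  also have "\<dots> = bsum (l + d) (\<lambda>j. ?g (p - i - (l + d) + int j))"
    using False by (intro bsum_reverse) auto
  also have "\<dots> = 0" using i by (intro A_total_vanish) auto
  finally show ?thesis .
qed

lemma mode_add_left:
  assumes u: "u \<in> Vg n" "u' \<in> Vg n" and c: "c \<in> Vg k"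
  shows "mode d n (sV a u + u') m \<phi> k c = a * mode d n u m \<phi> k c + mode d n u' m \<phi> k c"
proof (cases "d < 0 \<or> k < 0")
  case True
  then show ?thesis using u c by (simp add: mode_trivial Vg_add Vg_scale)
next
  case False
  have e: "\<phi> (k + n - s - 1) (Y c s (sV a u + u')) =
      a * \<phi> (k + n - s - 1) (Y c s u) + \<phi> (k + n - s - 1) (Y c s u')" for s
    using u c by (simp add: Y_right mc_lin Vg_Y)
  have "adm (k + d) (- d - 2) (\<lambda>s. \<phi> (k + n - s - 1) (Y c s u))"
    "adm (k + d) (- d - 2) (\<lambda>s. \<phi> (k + n - s - 1) (Y c s u'))"
    using False u c by (auto intro!: mc_adm)
  thus ?thesis unfolding mode_def e
    by (simp add: res_add[OF adm_cmult] res_cmult)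
qed

end

lemma mode_cong:
  assumes "c \<in> Vg k" "u \<in> Vg n" "\<And>k c. c \<in> Vg k \<Longrightarrow> \<phi> k c = \<psi> k c"
  shows "mode d n u m \<phi> k c = mode d n u m \<psi> k c"
  unfolding mode_def using assms Vg_Y by simp

lemma mode_lincomb:
  assumes \<phi>: "matcoeff d \<phi>" and \<psi>: "matcoeff d \<psi>" and "c \<in> Vg k" "u \<in> Vg n"
  shows "mode d n u m (\<lambda>k c. a * \<phi> k c + \<psi> k c) k c = a * mode d n u m \<phi> k c + mode d n u m \<psi> k c"
proof (cases "d < 0 \<or> k < 0")
  case True
  then show ?thesis
    using assms mc_trivial[OF \<phi> True, of c u n] mc_trivial[OF \<psi> True, of c u n] by (simp add: mode_def)
next
  case False
  have "adm (k + d) (- d - 2) (\<lambda>s. \<phi> (k + n - s - 1) (Y c s u))"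
    "adm (k + d) (- d - 2) (\<lambda>s. \<psi> (k + n - s - 1) (Y c s u))"
    using False assms by (auto intro!: mc_adm)
  thus ?thesis unfolding mode_def by (simp add: res_add[OF adm_cmult] res_cmult)
qed

lemma matcoeff_zero: "matcoeff d (\<lambda>k c. 0)"
  unfolding matcoeff_def by simp

lemma matcoeff_lincomb:
  assumes "matcoeff d \<phi>" "matcoeff d \<psi>"
  shows "matcoeff d (\<lambda>k c. a * \<phi> k c + \<psi> k c)"
proof -
  have fin: "fin_supp (\<lambda>j. f (k + l - (s + int j) - 1) (Y c (s + int j) b))"
    if "matcoeff d f" "c \<in> Vg k" "b \<in> Vg l" for f k l c b s
    by (rule fin_suppI[of "nat (k + l - s)"]) (use that Y_trunc mc_0 in auto)
  show ?thesis using assms unfolding matcoeff_def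
    using fin[OF assms(1)] fin[OF assms(2)]
    by (auto simp: algebra_simps bsum_add bsum_cmult fin_supp_mult)
qed

end

section \<open>Evaluation of words\<close>

definition wdeg :: "(int \<times> 'v \<times> int) list \<Rightarrow> int" where
  "wdeg ws = sum_list (map (\<lambda>(n, u, m). n - m - 1) ws)"

lemma wdeg_simps [simp]: "wdeg [] = 0" "wdeg ((n, u, m) # ws) = n - m - 1 + wdeg ws"
  unfolding wdeg_def by simp_all

lemma deg_key_wdeg: "deg_key x = wdeg (fst x)"
  unfolding deg_key_def wdeg_def ..

lemma validw_simps [simp]: "validw Vg []" "validw Vg ((n, u, m) # ws) \<longleftrightarrow> u \<in> Vg n \<and> validw Vg ws"
  unfolding validw_def by auto

lemma homog_finite: "homog Vg d f \<Longrightarrow> finite {x. f x \<noteq> 0}"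
  unfolding homog_def by blast

lemma homog_supp: "homog Vg d f \<Longrightarrow> f x \<noteq> 0 \<Longrightarrow> validw Vg (fst x) \<and> wdeg (fst x) = d"
  unfolding homog_def deg_key_wdeg by blast

lemma homog_zero: "homog Vg d (\<lambda>x. 0)"
  unfolding homog_def by simp

lemma homog_cmult: "homog Vg d f \<Longrightarrow> homog Vg d (\<lambda>x. a * f x)"
  unfolding homog_def by (auto elim: rev_finite_subset)

lemma homog_add:
  assumes "homog Vg d f" "homog Vg d g"
  shows "homog Vg d (\<lambda>x. f x + g x)"
proof -
  have "finite {x. f x + g x \<noteq> 0}"
    by (rule finite_subset[OF _ finite_UnI[OF assms[THEN homog_finite]]]) auto
  moreover have "validw Vg (fst x) \<and> deg_key x = d" if "f x + g x \<noteq> 0" for x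
  proof -
    have "f x \<noteq> 0 \<or> g x \<noteq> 0" using that by auto
    thus ?thesis using assms unfolding homog_def by blast
  qed
  ultimately show ?thesis unfolding homog_def by blast
qed

lemma homog_diff: "homog Vg d f \<Longrightarrow> homog Vg d g \<Longrightarrow> homog Vg d (\<lambda>x. f x - g x)"
  using homog_add[of Vg d f "\<lambda>x. -1 * g x"] homog_cmult[of Vg d g "-1"] by simp

lemma homog_sum:
  assumes "finite I" "\<And>i. i \<in> I \<Longrightarrow> homog Vg d (f i)"
  shows "homog Vg d (\<lambda>x. \<Sum>i\<in>I. f i x)"
  using assms by (induction I rule: finite_induct) (auto intro: homog_zero homog_add)

lemma homog_ebas: "validw Vg (fst x) \<Longrightarrow> wdeg (fst x) = d \<Longrightarrow> homog Vg d (ebas x)"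
  unfolding homog_def ebas_def deg_key_wdeg by auto

lemma act_supp: "{x. act a f x \<noteq> 0} = (\<lambda>(ws, w). (a # ws, w)) ` {x. f x \<noteq> 0}"
proof -
  have "(ws, w) \<in> {x. act a f x \<noteq> 0} \<longleftrightarrow> (\<exists>ws'. ws = a # ws' \<and> f (ws', w) \<noteq> 0)" for ws w
    unfolding act_def by (auto split: list.splits)
  thus ?thesis by force
qed

lemma act_Cons [simp]: "act a f (a # ws, w) = f (ws, w)"
  unfolding act_def by simp

lemma homog_act:
  assumes "homog Vg d f" "u \<in> Vg n" "d' = n - m - 1 + d"
  shows "homog Vg d' (act (n, u, m) f)"
  unfolding homog_def
proof (intro conjI allI impI)
  show "finite {x. act (n, u, m) f x \<noteq> 0}"
    unfolding act_supp by (rule finite_imageI[OF homog_finite[OF assms(1)]])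
  fix x :: "('a, 'b) key" assume "act (n, u, m) f x \<noteq> 0"
  hence "x \<in> (\<lambda>(ws, w). ((n, u, m) # ws, w)) ` {x. f x \<noteq> 0}" unfolding act_supp[symmetric] by simp
  then obtain ws w where "x = ((n, u, m) # ws, w)" "f (ws, w) \<noteq> 0" by auto
  thus "validw Vg (fst x)" "deg_key x = d'"
    using homog_supp[OF assms(1), of "(ws, w)"] assms by (auto simp: deg_key_wdeg)
qed

lemma act_ebas: "act a (ebas (ws, w)) = ebas (a # ws, w)"
  unfolding act_def ebas_def by (auto simp: fun_eq_iff split: list.splits)

lemma act_diff: "act a (\<lambda>x. f x - g x) = (\<lambda>x. act a f x - act a g x)"
  unfolding act_def by (auto simp: fun_eq_iff split: list.splits)

lemma act_cmult: "act a (\<lambda>x. c * f x) = (\<lambda>x. c * act a f x)"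
  unfolding act_def by (auto simp: fun_eq_iff split: list.splits)

lemma actw_simps [simp]: "actw [] f = f" "actw (a # ws) f = act a (actw ws f)"
  unfolding actw_def by simp_all

lemma actw_ebas: "actw ws (ebas (ws', w)) = ebas (ws @ ws', w)"
  by (induction ws) (simp_all add: act_ebas)

lemma actw_diff: "actw ws (\<lambda>x. f x - g x) = (\<lambda>x. actw ws f x - actw ws g x)"
  by (induction ws) (simp_all add: act_diff)

lemma actw_cmult: "actw ws (\<lambda>x. c * f x) = (\<lambda>x. c * actw ws f x)"
  by (induction ws) (simp_all add: act_cmult)

context graded_va
begin

fun wval :: "(int \<Rightarrow> 'v \<Rightarrow> complex) \<Rightarrow> (int \<times> 'v \<times> int) list \<Rightarrow> int \<Rightarrow> 'v \<Rightarrow> complex" where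
  "wval \<phi> [] = \<phi>"
| "wval \<phi> ((n, u, m) # ws) = mode (wdeg ws) n u m (wval \<phi> ws)"

lemma wval_matcoeff: "matcoeff 0 \<phi> \<Longrightarrow> validw Vg ws \<Longrightarrow> matcoeff (wdeg ws) (wval \<phi> ws)"
proof (induction \<phi> ws rule: wval.induct)
  case (2 \<phi> n u m ws)
  then have "matcoeff (wdeg ws + n - m - 1) (mode (wdeg ws) n u m (wval \<phi> ws))"
    by (intro mode_matcoeff) auto
  thus ?case by (simp add: algebra_simps)
qed simp

lemma matcoeff_sum:
  assumes "finite F" "\<And>x. x \<in> F \<Longrightarrow> matcoeff d (\<phi> x)"
  shows "matcoeff d (\<lambda>k c. \<Sum>x\<in>F. a x * \<phi> x k c)"
  using assms
  by (induction F rule: finite_induct) (auto intro: matcoeff_zero matcoeff_lincomb)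

lemma mode_sum:
  assumes "finite F" "\<And>x. x \<in> F \<Longrightarrow> matcoeff d (\<phi> x)" "c \<in> Vg k" "u \<in> Vg n"
  shows "mode d n u m (\<lambda>k c. \<Sum>x\<in>F. a x * \<phi> x k c) k c = (\<Sum>x\<in>F. a x * mode d n u m (\<phi> x) k c)"
  using assms
proof (induction F rule: finite_induct)
  case empty
  then show ?case by (simp add: mode_def)
next
  case (insert y F)
  have "matcoeff d (\<lambda>k c. \<Sum>x\<in>F. a x * \<phi> x k c)" using insert by (intro matcoeff_sum) auto
  then show ?case using insert by (simp add: mode_lincomb)
qed

end

section \<open>Coefficients on \<open>M\<close> and the evaluation of tensors\<close>

locale va_module = graded_va sV Y vac Vg
  for sV :: "complex \<Rightarrow> 'v::ab_group_add \<Rightarrow> 'v" and Y vac Vg +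
  fixes sM :: "complex \<Rightarrow> 'm::ab_group_add \<Rightarrow> 'm"
    and rho :: "'v \<Rightarrow> 'm \<Rightarrow> 'm"
    and lam :: "'m \<Rightarrow> complex"
  assumes AV: "AV_module sV Y vac Vg sM rho"
    and lam: "lam (sM a x + y) = a * lam x + lam y"
begin

lemma M_vs: "Vector_Spaces.vector_space sM"
  and rho_left: "rho (sV a u + u') w = sM a (rho u w) + rho u' w"
  and rho_right: "rho u (sM a w + w') = sM a (rho u w) + rho u w'"
  and rho_O: "u \<in> Vg n \<Longrightarrow> s \<le> -2 \<Longrightarrow> rho (zhu_O_gen sV Y n u s v) w = 0"
  and rho_star: "u \<in> Vg n \<Longrightarrow> rho (zhu_star sV Y n u v) w = rho u (rho v w)"
  and rho_vac: "rho vac w = w"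
proof -
  note av = AV[unfolded AV_module_def]
  show "Vector_Spaces.vector_space sM" by (rule av[THEN conjunct1])
  show "rho (sV a u + u') w = sM a (rho u w) + rho u' w"
    by (rule av[THEN conjunct2, THEN conjunct1, rule_format])
  show "rho u (sM a w + w') = sM a (rho u w) + rho u w'"
    by (rule av[THEN conjunct2, THEN conjunct2, THEN conjunct1, rule_format])
  show "u \<in> Vg n \<Longrightarrow> s \<le> -2 \<Longrightarrow> rho (zhu_O_gen sV Y n u s v) w = 0"
    by (rule av[THEN conjunct2, THEN conjunct2, THEN conjunct2, THEN conjunct1, rule_format])
  show "u \<in> Vg n \<Longrightarrow> rho (zhu_star sV Y n u v) w = rho u (rho v w)"
    by (rule av[THEN conjunct2, THEN conjunct2, THEN conjunct2, THEN conjunct2, THEN conjunct1, rule_format])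
  show "rho vac w = w"
    by (rule av[THEN conjunct2, THEN conjunct2, THEN conjunct2, THEN conjunct2, THEN conjunct2, rule_format])
qed

sublocale M: vector_space sM by (rule M_vs)

lemma lam_0 [simp]: "lam 0 = 0"
  using lam[of 1 0 0] by simp

text \<open>The linear form makes the coefficients complex numbers, as \<open>bsum\<close> and
  \<open>res\<close> require. The weight is ignored since c(k-1) acts on \<open>M\<close> as
  \<open>rho c\<close> for every weight \<open>k\<close>.\<close>

definition top_coeff :: "'m \<Rightarrow> int \<Rightarrow> 'v \<Rightarrow> complex" where
  "top_coeff w = (\<lambda>k c. lam (rho c w))"

lemma top_lin: "lam (rho (sV a x + y) w) = a * lam (rho x w) + lam (rho y w)"
  by (simp add: rho_left lam)

lemma top_0: "lam (rho 0 w) = 0"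
  using top_lin[of 1 0 0 w] by simp

lemma top_sum: "finite F \<Longrightarrow> lam (rho (\<Sum>i\<in>F. sV (a i) (x i)) w) = (\<Sum>i\<in>F. a i * lam (rho (x i) w))"
  by (induction F rule: finite_induct) (simp_all add: top_0 top_lin)

lemma top_zhu:
  assumes "k \<ge> 0"
  shows "bsum k (\<lambda>j. lam (rho (Y c (s + int j) b) w)) = lam (rho (zhu_O_gen sV Y k c s b) w)"
  unfolding zhu_O_gen_def bsum_nat[OF assms] top_sum[OF finite_atMost] using assms
  by (intro sum.cong refl) (simp add: binomial_gbinomial)

lemma top_matcoeff: "matcoeff 0 (top_coeff w)"
proof -
  have "bsum k (\<lambda>j. lam (rho (Y c (s + int j) b) w)) = 0"
    if "c \<in> Vg k" "s \<le> -2" for k c s b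
  proof (cases "k < 0")
    case True
    hence "c = 0" using that Vg_neg by auto
    then show ?thesis by (simp add: top_0)
  next
    case False
    then show ?thesis using that by (simp add: top_zhu rho_O)
  qed
  thus ?thesis unfolding matcoeff_def top_coeff_def by (simp add: top_lin)
qed

text \<open>Relation (2): the factor left besides (1 + y)^k is (1 + y)^(-1). In its expansion at
  infinity the term i = 0 gives the Zhu product, and those with i \<ge> 1 fall into O(V).\<close>

lemma top_mode:
  assumes "u \<in> Vg n" "c \<in> Vg k"
  shows "mode 0 n u (n - 1) (top_coeff w) k c = top_coeff (rho u w) k c"
proof (cases "k < 0")
  case True
  hence "c = 0" using assms Vg_neg by auto
  then show ?thesis using mode_trivial[OF top_matcoeff _ assms(2,1)] True by (simp add: top_coeff_def top_0)
next
  case False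
  have "mode 0 n u (n - 1) (top_coeff w) k c =
      bsum (-1) (\<lambda>i. bsum k (\<lambda>j. lam (rho (Y c (-1 - int i + int j) u) w)))"
    unfolding mode_def res_def top_coeff_def by simp
  also have "\<dots> = (\<Sum>i<1. (of_int (-1) gchoose i) * bsum k (\<lambda>j. lam (rho (Y c (-1 - int i + int j) u) w)))"
    by (rule bsum_eq_sum) (use False assms in \<open>simp add: top_zhu rho_O\<close>)
  also have "\<dots> = lam (rho (zhu_star sV Y k c u) w)"
    using False top_zhu[of k c "-1" u w] by (simp add: zhu_star_def)
  finally show ?thesis using assms by (simp add: rho_star top_coeff_def)
qed

definition kval :: "('v, 'm) key \<Rightarrow> int \<Rightarrow> 'v \<Rightarrow> complex" where
  "kval x = wval (top_coeff (snd x)) (fst x)"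

definition ev :: "(('v, 'm) key \<Rightarrow> complex) \<Rightarrow> int \<Rightarrow> 'v \<Rightarrow> complex" where
  "ev f = (\<lambda>k c. \<Sum>x | f x \<noteq> 0. f x * kval x k c)"

lemma ev_superset: "finite X \<Longrightarrow> {x. f x \<noteq> 0} \<subseteq> X \<Longrightarrow> ev f k c = (\<Sum>x\<in>X. f x * kval x k c)"
  unfolding ev_def by (rule sum.mono_neutral_left) auto

lemma ev_ebas: "ev (ebas x) k c = kval x k c"
  by (subst ev_superset[of "{x}"]) (auto simp: ebas_def)

lemma ev_sum:
  assumes "finite I" "\<And>i. i \<in> I \<Longrightarrow> finite {x. f i x \<noteq> 0}"
  shows "ev (\<lambda>x. \<Sum>i\<in>I. a i * f i x) k c = (\<Sum>i\<in>I. a i * ev (f i) k c)"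
proof -
  let ?X = "\<Union>i\<in>I. {x. f i x \<noteq> 0}"
  have X: "finite ?X" using assms by auto
  have "ev (f i) k c = (\<Sum>x\<in>?X. f i x * kval x k c)" if "i \<in> I" for i
    using that by (intro ev_superset X) auto
  moreover have "{x. (\<Sum>i\<in>I. a i * f i x) \<noteq> 0} \<subseteq> ?X"
    by (auto dest: sum.not_neutral_contains_not_neutral)
  hence "ev (\<lambda>x. \<Sum>i\<in>I. a i * f i x) k c = (\<Sum>x\<in>?X. (\<Sum>i\<in>I. a i * f i x) * kval x k c)"
    by (rule ev_superset[OF X])
  ultimately show ?thesis
    by (simp add: sum_distrib_left sum_distrib_right mult.assoc) (rule sum.swap)
qed

lemma ev_diff:
  assumes "finite {x. f x \<noteq> 0}" "finite {x. g x \<noteq> 0}"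
  shows "ev (\<lambda>x. f x - g x) k c = ev f k c - ev g k c"
proof -
  let ?X = "{x. f x \<noteq> 0} \<union> {x. g x \<noteq> 0}"
  have X: "finite ?X" using assms by simp
  have "ev f k c = (\<Sum>x\<in>?X. f x * kval x k c)" "ev g k c = (\<Sum>x\<in>?X. g x * kval x k c)"
    "ev (\<lambda>x. f x - g x) k c = (\<Sum>x\<in>?X. (f x - g x) * kval x k c)"
    by (rule ev_superset[OF X]; auto)+
  thus ?thesis by (simp add: sum_subtractf left_diff_distrib)
qed

lemma ev_cmult:
  assumes "finite {x. f x \<noteq> 0}"
  shows "ev (\<lambda>x. a * f x) k c = a * ev f k c"
  using ev_sum[of "{()}" "\<lambda>_. f" "\<lambda>_. a" k c] assms by simp

lemma ev_lincomb:
  assumes "homog Vg d f" "homog Vg d g" "homog Vg d h"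
  shows "ev (\<lambda>x. f x - a * g x - h x) k c = ev f k c - a * ev g k c - ev h k c"
  unfolding ev_diff[OF homog_finite[OF homog_diff[OF assms(1) homog_cmult[OF assms(2)]]]
      homog_finite[OF assms(3)]]
    ev_diff[OF homog_finite[OF assms(1)] homog_finite[OF homog_cmult[OF assms(2)]]]
    ev_cmult[OF homog_finite[OF assms(2)]] ..

lemma kval_matcoeff: "validw Vg (fst x) \<Longrightarrow> matcoeff (wdeg (fst x)) (kval x)"
  unfolding kval_def by (rule wval_matcoeff[OF top_matcoeff])

lemma kval_matcoeff_supp: "homog Vg d f \<Longrightarrow> x \<in> {x. f x \<noteq> 0} \<Longrightarrow> matcoeff d (kval x)"
  using homog_supp[of Vg d f x] kval_matcoeff[of x] by auto

lemma ev_matcoeff: "homog Vg d f \<Longrightarrow> matcoeff d (ev f)"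
  unfolding ev_def by (rule matcoeff_sum[OF homog_finite kval_matcoeff_supp])

lemma ev_act:
  assumes f: "homog Vg d f" and u: "u \<in> Vg n" and c: "c \<in> Vg k"
  shows "ev (act (n, u, m) f) k c = mode d n u m (ev f) k c"
proof -
  have inj: "inj_on (\<lambda>(ws, w). ((n, u, m) # ws, w)) {x. f x \<noteq> 0}" by (auto simp: inj_on_def)
  have "ev (act (n, u, m) f) k c = (\<Sum>x | f x \<noteq> 0. f x * mode d n u m (kval x) k c)"
    unfolding ev_def act_supp sum.reindex[OF inj]
  proof (rule sum.cong[OF refl])
    fix x assume "x \<in> {x. f x \<noteq> 0}"
    then show "((\<lambda>x. act (n, u, m) f x * kval x k c) \<circ> (\<lambda>(ws, w). ((n, u, m) # ws, w))) x =
        f x * mode d n u m (kval x) k c"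
      using homog_supp[OF f, of x] by (cases x) (auto simp: kval_def)
  qed
  also have "\<dots> = mode d n u m (ev f) k c"
    unfolding ev_def
    by (rule mode_sum[OF homog_finite[OF f] kval_matcoeff_supp[OF f] c u, symmetric])
  finally show ?thesis .
qed

text \<open>Homogeneity is part of the notion because the degree enters \<open>mode\<close>, through
  which a letter acts on evaluations.\<close>

definition null :: "(('v, 'm) key \<Rightarrow> complex) \<Rightarrow> bool" where
  "null f \<longleftrightarrow> (\<exists>d. homog Vg d f) \<and> (\<forall>k c. c \<in> Vg k \<longrightarrow> ev f k c = 0)"

lemma null_act:
  assumes "null f" "u \<in> Vg n"
  shows "null (act (n, u, m) f)"
proof -
  obtain d where d: "homog Vg d f" using assms unfolding null_def by auto
  have "ev (act (n, u, m) f) k c = 0" if "c \<in> Vg k" for k c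
  proof -
    have "ev (act (n, u, m) f) k c = mode d n u m (ev f) k c" by (rule ev_act[OF d assms(2) that])
    also have "\<dots> = mode d n u m (\<lambda>k c. 0) k c"
      using assms by (intro mode_cong that) (auto simp: null_def)
    finally show ?thesis by (simp add: mode_def)
  qed
  thus ?thesis unfolding null_def using homog_act[OF d assms(2) refl] by blast
qed

lemma null_actw: "null f \<Longrightarrow> validw Vg ws \<Longrightarrow> null (actw ws f)"
  by (induction ws) (auto intro: null_act)

section \<open>Vanishing on the generators of I and J\<close>

lemma null_LinGen:
  assumes "g \<in> LinGen sV Vg sM"
  shows "null g"
proof -
  consider (V) xs ys n u u' m a w where
      "g = (\<lambda>x. ebas (xs @ [(n, sV a u + u', m)] @ ys, w) x - a * ebas (xs @ [(n, u, m)] @ ys, w) x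
            - ebas (xs @ [(n, u', m)] @ ys, w) x)"
      "validw Vg xs" "validw Vg ys" "u \<in> Vg n" "u' \<in> Vg n"
    | (M) ws a w w' where
      "g = (\<lambda>x. ebas (ws, sM a w + w') x - a * ebas (ws, w) x - ebas (ws, w') x)" "validw Vg ws"
    using assms unfolding LinGen_def by blast
  then show ?thesis
  proof cases
    case V
    \<comment> \<open>It suffices to treat the changed letter at the head of the word; the prefix
      \<open>xs\<close> is restored by \<open>null_actw\<close>.\<close>
    let ?e = "\<lambda>u. ebas ((n, u, m) # ys, w)"
    let ?g = "\<lambda>x. ?e (sV a u + u') x - a * ?e u x - ?e u' x"
    have h: "homog Vg (n - m - 1 + wdeg ys) (?e x)" if "x \<in> Vg n" for x
      using that V by (intro homog_ebas) auto
    note h' = h[OF Vg_add[OF Vg_scale[OF V(4), of a] V(5)]] h[OF V(4)] h[OF V(5)]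
    have "ev ?g k c = 0" if "c \<in> Vg k" for k c
    proof -
      have "ev ?g k c = kval ((n, sV a u + u', m) # ys, w) k c - a * kval ((n, u, m) # ys, w) k c
         - kval ((n, u', m) # ys, w) k c"
        unfolding ev_lincomb[OF h'] ev_ebas ..
      thus ?thesis
        using mode_add_left[OF kval_matcoeff[of "(ys, w)"] V(4,5) that, of a m] V(3) by (simp add: kval_def)
    qed
    hence "null ?g" unfolding null_def
      using homog_diff[OF homog_diff[OF h'(1) homog_cmult[OF h'(2)]] h'(3)] by blast
    hence "null (actw xs ?g)" using V by (intro null_actw)
    thus ?thesis unfolding V(1) by (simp add: actw_diff actw_cmult actw_ebas)
  next
    case M
    let ?g = "\<lambda>x. ebas ([], sM a w + w') x - a * ebas ([], w) x - ebas ([], w') x"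
    have h: "homog Vg 0 (ebas ([], x))" for x by (rule homog_ebas) auto
    have "ev ?g k c = 0" for k c
      unfolding ev_lincomb[OF h h h] ev_ebas by (simp add: kval_def top_coeff_def rho_right lam)
    moreover have "homog Vg 0 ?g" by (intro homog_diff homog_cmult h)
    ultimately have "null ?g" unfolding null_def by blast
    hence "null (actw ws ?g)" using M by (intro null_actw)
    thus ?thesis unfolding M(1) by (simp add: actw_diff actw_cmult actw_ebas)
  qed
qed

lemma null_Gen1:
  assumes "g \<in> Gen1 Vg"
  shows "null g"
proof -
  obtain n u m f d where g: "g = act (n, u, m) f" "u \<in> Vg n" "homog Vg d f" "n - m - 1 + d < 0"
    using assms unfolding Gen1_def by blast
  have "ev g k c = 0" if "c \<in> Vg k" for k c
    unfolding g(1) ev_act[OF g(3,2) that]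
    by (rule mode_vanish[OF ev_matcoeff[OF g(3)] _ that g(2)]) (use g in simp)
  thus ?thesis unfolding null_def g(1) using homog_act[OF g(3,2) refl] by blast
qed

lemma null_Gen2:
  assumes "g \<in> Gen2 Vg rho"
  shows "null g"
proof -
  obtain n u w where g: "g = (\<lambda>x. ebas ([(n, u, n - 1)], w) x - ebas ([], rho u w) x)" "u \<in> Vg n"
    using assms unfolding Gen2_def by blast
  have h: "homog Vg 0 (ebas ([(n, u, n - 1)], w))" "homog Vg 0 (ebas ([], rho u w))"
    by (rule homog_ebas; use g in simp)+
  have "ev g k c = 0" if "c \<in> Vg k" for k c
    unfolding g(1) ev_diff[OF h[THEN homog_finite]] ev_ebas
    using top_mode[OF g(2) that] by (simp add: kval_def)
  thus ?thesis unfolding null_def g(1) using homog_diff[OF h] by blast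
qed

lemma null_Gen3:
  assumes "g \<in> Gen3 Y Vg"
  shows "null g"
proof -
  obtain n1 n2 u v p q d f where
    g: "g = (\<lambda>x. act (n1, u, p) (act (n2, v, q) f) x -
          (\<Sum>i<nat (n2 + d - q). \<Sum>j\<in>{0..n1 + d}.
             ((of_int (p - n1 - d)) gchoose i) * ((of_int (n1 + d)) gchoose (nat j)) *
             act (n1 + n2 - (p - n1 - d - int i + j) - 1, Y u (p - n1 - d - int i + j) v,
                  q + n1 + d + int i - j) f x))"
    and u: "u \<in> Vg n1" and v: "v \<in> Vg n2" and f: "homog Vg d f" and q: "n2 + d > q"
    using assms unfolding Gen3_def by blast
  let ?D = "d + n2 - q - 1"
  let ?d = "n1 - p - 1 + ?D"
  let ?b = "\<lambda>i j. ((of_int (p - n1 - d)) gchoose i) * ((of_int (n1 + d)) gchoose (nat j)) :: complex"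
  let ?t = "\<lambda>i j. act (n1 + n2 - (p - n1 - d - int i + j) - 1, Y u (p - n1 - d - int i + j) v,
                  q + n1 + d + int i - j) f"
  have h1: "homog Vg ?D (act (n2, v, q) f)" by (rule homog_act[OF f v]) simp
  have h2: "homog Vg ?d (act (n1, u, p) (act (n2, v, q) f))" by (rule homog_act[OF h1 u refl])
  have ht: "homog Vg ?d (?t i j)" for i j
    by (rule homog_act[OF f Vg_Y[OF u v]]) simp
  have hi: "homog Vg ?d (\<lambda>x. \<Sum>j\<in>{0..n1 + d}. ?b i j * ?t i j x)" for i
    by (intro homog_sum homog_cmult ht) simp
  have hs: "homog Vg ?d (\<lambda>x. \<Sum>i<nat (n2 + d - q). \<Sum>j\<in>{0..n1 + d}. ?b i j * ?t i j x)"
    by (intro homog_sum hi) simp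
  have "ev g k c = 0" if c: "c \<in> Vg k" for k c
  proof -
    have "ev (act (n1, u, p) (act (n2, v, q) f)) k c = mode ?D n1 u p (ev (act (n2, v, q) f)) k c"
      by (rule ev_act[OF h1 u c])
    also have "\<dots> = mode ?D n1 u p (mode d n2 v q (ev f)) k c"
      by (rule mode_cong[OF c u]) (rule ev_act[OF f v])
    also have "\<dots> = (\<Sum>i<nat (n2 + d - q). \<Sum>j\<in>{0..n1 + d}. ?b i j *
       mode d (n1 + n2 - (p - n1 - d - int i + j) - 1) (Y u (p - n1 - d - int i + j) v)
         (q + n1 + d + int i - j) (ev f) k c)"
      by (rule mode_product[OF ev_matcoeff[OF f] u v c q])
    also have "\<dots> = (\<Sum>i<nat (n2 + d - q). \<Sum>j\<in>{0..n1 + d}. ?b i j * ev (?t i j) k c)"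
      by (simp only: ev_act[OF f Vg_Y[OF u v] c])
    also have "\<dots> = (\<Sum>i<nat (n2 + d - q). ev (\<lambda>x. \<Sum>j\<in>{0..n1 + d}. ?b i j * ?t i j x) k c)"
      by (intro sum.cong refl ev_sum[symmetric] homog_finite[OF ht]) simp
    also have "\<dots> = ev (\<lambda>x. \<Sum>i<nat (n2 + d - q). \<Sum>j\<in>{0..n1 + d}. ?b i j * ?t i j x) k c"
      using ev_sum[of "{..<nat (n2 + d - q)}" "\<lambda>i x. \<Sum>j\<in>{0..n1 + d}. ?b i j * ?t i j x" "\<lambda>_. 1" k c]
        homog_finite[OF hi] by simp
    finally show ?thesis unfolding g ev_diff[OF homog_finite[OF h2] homog_finite[OF hs]] by simp
  qed
  thus ?thesis unfolding null_def g using homog_diff[OF h2 hs] by blast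
qed

lemma null_Jgen:
  assumes "g \<in> Jgen Y Vg"
  shows "null g"
proof -
  obtain n1 n2 u v p q d f i where
    g: "g = (\<lambda>x. \<Sum>j\<in>{0..n1 + d}. ((of_int (n1 + d)) gchoose (nat j)) *
             act (n1 + n2 - (p - i - j) - 1, Y u (p - i - j) v, q + i + j) f x)"
    and u: "u \<in> Vg n1" and v: "v \<in> Vg n2" and f: "homog Vg d f" and i: "i \<ge> n2 + d - q"
    using assms unfolding Jgen_def by blast
  let ?t = "\<lambda>j. act (n1 + n2 - (p - i - j) - 1, Y u (p - i - j) v, q + i + j) f"
  have ht: "homog Vg (n1 + n2 - p - q - 2 + d) (?t j)" for j
    by (rule homog_act[OF f Vg_Y[OF u v]]) simp
  have "ev g k c = 0" if c: "c \<in> Vg k" for k c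
  proof -
    have "ev g k c = (\<Sum>j\<in>{0..n1 + d}. ((of_int (n1 + d)) gchoose (nat j)) * ev (?t j) k c)"
      unfolding g by (intro ev_sum homog_finite[OF ht]) simp
    thus ?thesis
      unfolding ev_act[OF f Vg_Y[OF u v] c] mode_iterate_vanish[OF ev_matcoeff[OF f] u v c i] .
  qed
  moreover have "homog Vg (n1 + n2 - p - q - 2 + d) g"
    unfolding g by (intro homog_sum homog_cmult ht) simp
  ultimately show ?thesis unfolding null_def by blast
qed

lemma ev_Tsub:
  assumes "f \<in> Tsub Vg (Igen sV Y Vg sM rho \<union> Jgen Y Vg)" "c \<in> Vg k"
  shows "ev f k c = 0"
proof -
  obtain F a where F: "finite F" "f = (\<lambda>x. \<Sum>g\<in>F. a g * g x)"
    "F \<subseteq> {actw ws g | ws g. validw Vg ws \<and> g \<in> Igen sV Y Vg sM rho \<union> Jgen Y Vg}"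
    using assms unfolding Tsub_def lspan_def by blast
  have n: "null g" if "g \<in> F" for g
  proof -
    obtain ws g' where "g = actw ws g'" "validw Vg ws" "g' \<in> Igen sV Y Vg sM rho \<union> Jgen Y Vg"
      using F(3) \<open>g \<in> F\<close> by blast
    moreover have "null g'" using calculation(3) null_LinGen null_Gen1 null_Gen2 null_Gen3 null_Jgen
      unfolding Igen_def by blast
    ultimately show ?thesis using null_actw by blast
  qed
  have "ev f k c = (\<Sum>g\<in>F. a g * ev g k c)"
    unfolding F(2) using n[unfolded null_def] by (intro ev_sum F(1)) (blast intro: homog_finite)
  also have "\<dots> = 0" using n assms by (intro sum.neutral) (auto simp: null_def)
  finally show ?thesis .
qed

lemma lam_ebas_Tsub:
  assumes "ebas ([], w) \<in> Tsub Vg (Igen sV Y Vg sM rho \<union> Jgen Y Vg)"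
  shows "lam w = 0"
proof -
  have 0: "lam (rho c w) = 0" if "c \<in> Vg k" for k c
    using ev_Tsub[OF assms that] by (simp add: ev_ebas kval_def top_coeff_def)
  \<comment> \<open>Evaluations vanish on homogeneous vectors, so the vacuum is split into
    components; that it acts as the identity then recovers \<open>lam w\<close>.\<close>
  obtain F c where F: "finite F" "\<forall>n\<in>F. c n \<in> Vg n" "vac = sum c F" using Vg_decomp by blast
  have "lam w = lam (rho (\<Sum>n\<in>F. sV 1 (c n)) w)" using F rho_vac by simp
  also have "\<dots> = (\<Sum>n\<in>F. 1 * lam (rho (c n) w))" by (rule top_sum[OF F(1)])
  also have "\<dots> = 0" using F(2) 0 by (intro sum.neutral) auto
  finally show ?thesis .
qed

end

section \<open>Linear forms on \<open>M\<close> and the conclusion\<close>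

lemma ebas_zero_in_Tsub: "ebas ([], 0) \<in> Tsub Vg (Igen sV Y Vg sM rho)"
  if "Vector_Spaces.vector_space sM"
proof -
  interpret vector_space sM by (rule that)
  \<comment> \<open>With coefficient -1 at zero vectors the linearity relation reads e + e - e = e
    for e = \<open>ebas ([], 0)\<close>.\<close>
  let ?g = "\<lambda>x. ebas ([], sM (-1) 0 + 0) x - (-1) * ebas ([], 0) x - ebas ([], 0) x"
  have "?g \<in> LinGen sV Vg sM"
    unfolding LinGen_def by (rule UnI2) (use validw_simps(1) in blast)
  moreover have "?g = ebas ([], 0)" by (simp add: fun_eq_iff)
  ultimately have "ebas ([], 0) \<in> Igen sV Y Vg sM rho" unfolding Igen_def by simp
  hence "ebas ([], 0) \<in> {actw ws g | ws g. validw Vg ws \<and> g \<in> Igen sV Y Vg sM rho}"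
    by (auto intro!: exI[of _ "[]"])
  thus ?thesis unfolding Tsub_def lspan_def
    by (intro CollectI exI[of _ "{ebas ([], 0)}"] exI[of _ "\<lambda>_. 1"]) auto
qed

text \<open>The coordinate at \<open>w\<close> with respect to a basis extending {w}.\<close>

lemma linear_form_separates:
  assumes "Vector_Spaces.vector_space sM" "w \<noteq> 0"
  obtains lam :: "'m::ab_group_add \<Rightarrow> complex"
  where "\<And>a x y. lam (sM a x + y) = a * lam x + lam y" "lam w = 1"
proof -
  interpret vector_space sM by (rule assms)
  have w: "independent {w}" using assms by simp
  let ?B = "extend_basis {w}"
  have B: "independent ?B" "span ?B = UNIV" "w \<in> ?B"
    using independent_extend_basis[OF w] span_extend_basis[OF w] extend_basis_superset[OF w] by auto
  show ?thesis
  proof (rule that[of "\<lambda>x. representation ?B x w"])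
    show "representation ?B (sM a x + y) w = a * representation ?B x w + representation ?B y w" for a x y
      using B by (simp add: representation_add representation_scale)
    show "representation ?B w w = 1" using B by (simp add: representation_basis)
  qed
qed

theorem theorem5p2:
  fixes sV :: "complex \<Rightarrow> 'v::ab_group_add \<Rightarrow> 'v"
    and Y :: "'v \<Rightarrow> int \<Rightarrow> 'v \<Rightarrow> 'v"
    and vac :: 'v
    and Vg :: "int \<Rightarrow> 'v set"
    and sM :: "complex \<Rightarrow> 'm::ab_group_add \<Rightarrow> 'm"
    and rho :: "'v \<Rightarrow> 'm \<Rightarrow> 'm"
    and w :: 'm
  assumes "N_graded_VA sV Y vac Vg"
    and "AV_module sV Y vac Vg sM rho"
    and "ebas ([], w) \<in> Tsub Vg (Igen sV Y Vg sM rho \<union> Jgen Y Vg)"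
  shows "ebas ([], w) \<in> Tsub Vg (Igen sV Y Vg sM rho)"
proof -
  have M: "Vector_Spaces.vector_space sM" using assms(2) unfolding AV_module_def by (rule conjunct1)
  \<comment> \<open>Stronger than vanishing in the quotient: \<open>w\<close> is zero in
    \<open>M\<close> itself, as no linear form separates it from zero.\<close>
  have "w = 0"
  proof (rule ccontr)
    assume "w \<noteq> 0"
    then obtain lam :: "'m \<Rightarrow> complex" where
      lin: "\<And>a x y. lam (sM a x + y) = a * lam x + lam y" and one: "lam w = 1"
      using linear_form_separates[OF M] by metis
    interpret va_module sV Y vac Vg sM rho lam
      by unfold_locales (use assms lin in auto)
    show False using lam_ebas_Tsub[OF assms(3)] one by simp
  qed
  thus ?thesis using ebas_zero_in_Tsub[OF M] by simp
qed

end
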